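(* Let $\mu\ge1/2$, $\sigma\ge1$, and let $\{\varphi_j\}_{j\in\mathbb N}$ be the orthonormal basis of $L^2(\mathbb R^n)$ of eigenfunctions of a normal, globally elliptic differential operator $P$ with polynomial coefficients, of order $m\ge2$, as described in the context. Let $\{a_j\}_{j\in\mathbb N}\subset(\mathcal G^\sigma)'(\mathbb T)$ be a sequence such that for every $\epsilon>0$ and $h>0$ there exists $C_{\epsilon,h}>0$ with $$|\langle a_j,\psi\rangle|\le C_{\epsilon,h}\|\psi\|_{\sigma,h}\exp\left(\epsilon j^{\frac1{2n\mu}}\right)\qquad\text{for all } j\in\mathbb N,\ \psi\in\mathcal G^{\sigma,h}(\mathbb T).$$ Then $$u(t,x)=\sum_{j\in\mathbb N}a_j\varphi_j(x)$$ belongs to $\mathcal S_{\sigma,\mu}'(\mathbb T\times\mathbb R^n)$. Moreover, $$\langle a_j,\psi(t)\rangle=\langle u,\psi(t)\varphi_j(x)\rangle\qquad\text{for all }\psi\in\mathcal G^\sigma(\mathbb T)\text{ and all } j\in\mathbb N.$$ (In this situation one may write $\{a_j\}\rightsquigarrow u\in\mathcal S_{\sigma,\mu}'(\mathbb T\times\mathbb R^n)$.)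
   Context: Notation: $\mathbb T=\mathbb R/2\pi\mathbb Z$, $\mathbb N_0=\{0,1,2,\dots\}$, $\mathbb N=\{1,2,\dots\}$. For $h>0$, $\mathcal G^{\sigma,h}(\mathbb T)$ is the Banach space of $\psi\in C^\infty(\mathbb T)$ with $\|\psi\|_{\sigma,h}=\sup_{k\in\mathbb N_0}\sup_t|\partial^k\psi(t)|h^{-k}(k!)^{-\sigma}<\infty$, and $\mathcal G^\sigma(\mathbb T)=\bigcup_{h>0}\mathcal G^{\sigma,h}(\mathbb T)$. $(\mathcal G^\sigma)'(\mathbb T)$ is the set of linear maps $v:\mathcal G^\sigma(\mathbb T)\to\mathbb C$ such that for every $h>0$ there is $C_h>0$ with $|\langle v,\psi\rangle|\le C_h\|\psi\|_{\sigma,h}$ for all $\psi\in\mathcal G^{\sigma}(\mathbb T)$ (the right-hand side may be $+\infty$). For $C>0$, $\mathcal S_{\sigma,\mu,C}$ is the Banach space of complex-valued $\varphi\in C^\infty(\mathbb T\times\mathbb R^n)$ with $$\|\varphi\|_{\sigma,\mu,C}=\sup_{\alpha,\beta\in\mathbb N_0^n,\,k\in\mathbb N_0}C^{-|\alpha+\beta|-k}(k!)^{-\sigma}(\alpha!\beta!)^{-\mu}\sup_{(t,x)}|x^\alpha\partial_x^\beta\partial_t^k\varphi(t,x)|<\infty ,$$ and $\mathcal S_{\sigma,\mu}(\mathbb T\times\mathbb R^n)=\bigcup_{C>0}\mathcal S_{\sigma,\mu,C}$. The space $\mathcal S_{\sigma,\mu}'(\mathbb T\times\mathbb R^n)$ consists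 of all linear forms $u:\mathcal S_{\sigma,\mu}\to\mathbb C$ such that for every $A>0$ there is $C_A>0$ with $|\langle u,\varphi\rangle|\le C_A\|\varphi\|_{\sigma,\mu,A}$ for all $\varphi\in\mathcal S_{\sigma,\mu}$ (the right-hand side may be $+\infty$). The form $a_j\varphi_j$ is defined by $\langle a_j\varphi_j,\theta\rangle=\left\langle a_j,\int_{\mathbb R^n}\theta(t,x)\varphi_j(x)\,dx\right\rangle$, and $u=\sum_ja_j\varphi_j$ means $\langle u,\theta\rangle=\lim_{N\to\infty}\sum_{j\le N}\langle a_j\varphi_j,\theta\rangle$ for every $\theta\in\mathcal S_{\sigma,\mu}$ (existence of these limits being part of the assertion). The operator $P$: $P=\sum_{|\alpha|+|\beta|\le m}c_{\alpha,\beta}x^\beta D_x^\alpha$, with $m\ge2$, $c_{\alpha,\beta}\in\mathbb C$, $D_x^\alpha=(-i)^{|\alpha|}\partial_x^\alpha$, satisfying $P^*P=PP^*$ and $\sum_{|\alpha|+|\beta|=m}c_{\alpha,\beta}x^\beta\xi^\alpha\ne0$ for all $(x,\xi)\ne(0,0)$. Associated with $P$ is an orthonormal basis $\{\varphi_j\}_{j\in\mathbb N}$ of $L^2(\mathbb R^n)$ of eigenfunctions of $P$, lying in the Gelfand-Shilov space $\mathcal S^{1/2}_{1/2}(\mathbb R^n)$ (the smooth $f$ on $\mathbb R^n$ for which there is $A>0$ with $\sup_{\alpha,\beta\in\mathbb N_0^n}\sup_x A^{-|\alpha+\beta|}(\alpha!\beta!)^{-1/2}|x^\alpha\partial_x^\beta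 f(x)|<\infty$), with real eigenvalues $\lambda_j$ such that $|\lambda_j|\to\infty$ and $|\lambda_j|\sim C j^{m/(2n)}$ as $j\to\infty$ for some $C>0$.
   Formalization: The final formula fails for complex-valued eigenfunctions since the pairing has no conjugation (e.g. φ_1 replaced by iφ_1); it is proved as ⟨a_j,ψ⟩=⟨u,ψ·conj(φ_j)⟩ in general, and literally as ⟨a_j,ψ⟩=⟨u,ψφ_j⟩ when all φ_j are real-valued. *)

theory Defs
  imports "HOL-Analysis.Analysis" "HOL-Library.Landau_Symbols"
begin

section \<open>Multi-indices, partial derivatives and smoothness\<close>

type_synonym 'n mindex = "'n \<Rightarrow> nat"

definition mi_size :: "'n::finite mindex \<Rightarrow> nat" where
  "mi_size \<alpha> = (\<Sum>i\<in>UNIV. \<alpha> i)"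

definition mi_fact :: "'n::finite mindex \<Rightarrow> real" where
  "mi_fact \<alpha> = (\<Prod>i\<in>UNIV. fact (\<alpha> i))"

definition mi_power :: "real ^ 'n \<Rightarrow> 'n::finite mindex \<Rightarrow> real" where
  "mi_power x \<alpha> = (\<Prod>i\<in>UNIV. (x $ i) ^ \<alpha> i)"

definition partial_deriv ::
  "'a::real_normed_vector \<Rightarrow> ('a \<Rightarrow> 'b::real_normed_vector) \<Rightarrow> 'a \<Rightarrow> 'b" where
  "partial_deriv b f x = vector_derivative (\<lambda>s. f (x + s *\<^sub>R b)) (at 0)"

text \<open>
  A function is of class \<open>C\<^sup>\<infinity>\<close> iff all its iterated partial derivatives
  exist and are differentiable.
\<close>
definition smooth :: "('a::euclidean_space \<Rightarrow> 'b::real_normed_vector) \<Rightarrow> bool" where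
  "smooth f \<longleftrightarrow> (\<forall>bs. set bs \<subseteq> Basis \<longrightarrow> foldr partial_deriv bs f differentiable_on UNIV)"

text \<open>
  The derivative of multi-order \<open>\<beta>\<close> in the directions \<open>e i\<close>. The directions are taken
  in the order of an arbitrary fixed enumeration of the index type; this order is
  irrelevant on smooth functions, to which alone the operator is applied.
\<close>
definition mi_deriv ::
  "('n::finite \<Rightarrow> 'a::real_normed_vector) \<Rightarrow> 'n mindex \<Rightarrow> ('a \<Rightarrow> 'b::real_normed_vector) \<Rightarrow> 'a \<Rightarrow> 'b" where
  "mi_deriv e \<beta> f =
     foldr (\<lambda>i. partial_deriv (e i) ^^ \<beta> i) (SOME is. distinct is \<and> set is = UNIV) f"

abbreviation deriv_x :: "'n::finite mindex \<Rightarrow> (real ^ 'n \<Rightarrow> complex) \<Rightarrow> real ^ 'n \<Rightarrow> complex" where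
  "deriv_x \<equiv> mi_deriv (\<lambda>i. axis i 1)"

abbreviation deriv_tx ::
  "nat \<Rightarrow> 'n::finite mindex \<Rightarrow> (real \<times> (real ^ 'n) \<Rightarrow> complex) \<Rightarrow> real \<times> (real ^ 'n) \<Rightarrow> complex" where
  "deriv_tx k \<beta> \<phi> \<equiv> mi_deriv (\<lambda>i. (0, axis i 1)) \<beta> ((partial_deriv (1, 0) ^^ k) \<phi>)"


section \<open>Gevrey functions and ultradistributions on the torus\<close>

text \<open>
  Functions on \<open>\<real>/2\<pi>\<int>\<close> are \<open>2\<pi>\<close>-periodic functions on \<open>\<real>\<close>. All the norms take values
  in \<open>[0,\<infinity>]\<close>.
\<close>

definition gevrey_norm :: "real \<Rightarrow> real \<Rightarrow> (real \<Rightarrow> complex) \<Rightarrow> ennreal" where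
  "gevrey_norm \<sigma> h \<psi> =
     (SUP k. SUP t. ennreal (cmod ((partial_deriv 1 ^^ k) \<psi> t) / (h ^ k * fact k powr \<sigma>)))"

definition gevrey_h :: "real \<Rightarrow> real \<Rightarrow> (real \<Rightarrow> complex) set" where
  "gevrey_h \<sigma> h = {\<psi>. smooth \<psi> \<and> (\<forall>t. \<psi> (t + 2 * pi) = \<psi> t) \<and> gevrey_norm \<sigma> h \<psi> < \<infinity>}"

definition gevrey :: "real \<Rightarrow> (real \<Rightarrow> complex) set" where
  "gevrey \<sigma> = (\<Union>h\<in>{0<..}. gevrey_h \<sigma> h)"

text \<open>
  Linear forms on a space \<open>V\<close> of complex-valued functions; their values outside \<open>V\<close> are
  unconstrained.
\<close>
definition linear_form_on :: "('a \<Rightarrow> complex) set \<Rightarrow> (('a \<Rightarrow> complex) \<Rightarrow> complex) \<Rightarrow> bool" where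
  "linear_form_on V v \<longleftrightarrow>
     (\<forall>f\<in>V. \<forall>g\<in>V. v (\<lambda>x. f x + g x) = v f + v g) \<and>
     (\<forall>z. \<forall>f\<in>V. v (\<lambda>x. z * f x) = z * v f)"

definition gevrey_dual :: "real \<Rightarrow> ((real \<Rightarrow> complex) \<Rightarrow> complex) set" where
  "gevrey_dual \<sigma> = {v. linear_form_on (gevrey \<sigma>) v \<and>
     (\<forall>h>0. \<exists>C>0. \<forall>\<psi>\<in>gevrey \<sigma>. ennreal (cmod (v \<psi>)) \<le> ennreal C * gevrey_norm \<sigma> h \<psi>)}"


section \<open>The space on the product of the torus with \<open>\<real>\<^sup>n\<close> and its dual\<close>

definition S_norm :: "real \<Rightarrow> real \<Rightarrow> real \<Rightarrow> (real \<times> (real ^ 'n::finite) \<Rightarrow> complex) \<Rightarrow> ennreal" where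
  "S_norm \<sigma> \<mu> C \<phi> =
     (SUP \<alpha>. SUP \<beta>. SUP k. SUP (t, x).
        ennreal (cmod (of_real (mi_power x \<alpha>) * deriv_tx k \<beta> \<phi> (t, x)) /
          (C ^ (mi_size \<alpha> + mi_size \<beta> + k) * fact k powr \<sigma> * (mi_fact \<alpha> * mi_fact \<beta>) powr \<mu>)))"

definition S_C_space :: "real \<Rightarrow> real \<Rightarrow> real \<Rightarrow> (real \<times> (real ^ 'n::finite) \<Rightarrow> complex) set" where
  "S_C_space \<sigma> \<mu> C =
     {\<phi>. smooth \<phi> \<and> (\<forall>t x. \<phi> (t + 2 * pi, x) = \<phi> (t, x)) \<and> S_norm \<sigma> \<mu> C \<phi> < \<infinity>}"

definition S_space :: "real \<Rightarrow> real \<Rightarrow> (real \<times> (real ^ 'n::finite) \<Rightarrow> complex) set" where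
  "S_space \<sigma> \<mu> = (\<Union>C\<in>{0<..}. S_C_space \<sigma> \<mu> C)"

definition S_dual :: "real \<Rightarrow> real \<Rightarrow> ((real \<times> (real ^ 'n::finite) \<Rightarrow> complex) \<Rightarrow> complex) set" where
  "S_dual \<sigma> \<mu> = {u. linear_form_on (S_space \<sigma> \<mu>) u \<and>
     (\<forall>A>0. \<exists>C>0. \<forall>\<phi>\<in>S_space \<sigma> \<mu>. ennreal (cmod (u \<phi>)) \<le> ennreal C * S_norm \<sigma> \<mu> A \<phi>)}"

text \<open>
  The pairing is bilinear: \<open>f\<close> is not conjugated. Hence the family dual to an orthonormal
  family \<open>\<phi> j\<close> is \<open>cnj (\<phi> j)\<close>, which is \<open>\<phi> j\<close> itself when \<open>\<phi> j\<close> is real-valued.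
\<close>
definition tensor_form ::
  "((real \<Rightarrow> complex) \<Rightarrow> complex) \<Rightarrow> (real ^ 'n::finite \<Rightarrow> complex) \<Rightarrow>
   (real \<times> (real ^ 'n) \<Rightarrow> complex) \<Rightarrow> complex" where
  "tensor_form a f \<theta> = a (\<lambda>t. \<integral>x. \<theta> (t, x) * f x \<partial>lborel)"


section \<open>Gelfand-Shilov functions and orthonormal bases on \<open>\<real>\<^sup>n\<close>\<close>

definition gelfand_shilov :: "real \<Rightarrow> (real ^ 'n::finite \<Rightarrow> complex) set" where
  "gelfand_shilov \<mu> = {f. smooth f \<and> (\<exists>A>0.
     (SUP \<alpha>. SUP \<beta>. SUP x.
        ennreal (cmod (of_real (mi_power x \<alpha>) * deriv_x \<beta> f x) /
          (A ^ (mi_size \<alpha> + mi_size \<beta>) * (mi_fact \<alpha> * mi_fact \<beta>) powr \<mu>))) < \<infinity>)}"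

definition square_integrable :: "('a::euclidean_space \<Rightarrow> complex) \<Rightarrow> bool" where
  "square_integrable f \<longleftrightarrow>
     f \<in> borel_measurable lborel \<and> integrable lborel (\<lambda>x. (cmod (f x))\<^sup>2)"

definition L2_inner :: "('a::euclidean_space \<Rightarrow> complex) \<Rightarrow> ('a \<Rightarrow> complex) \<Rightarrow> complex" where
  "L2_inner f g = (\<integral>x. f x * cnj (g x) \<partial>lborel)"

text \<open>The family is indexed by \<open>j = 1, 2, \<dots>\<close>; \<open>\<phi> 0\<close> plays no role.\<close>
definition orthonormal_basis_L2 :: "(nat \<Rightarrow> 'a::euclidean_space \<Rightarrow> complex) \<Rightarrow> bool" where
  "orthonormal_basis_L2 \<phi> \<longleftrightarrow>
     (\<forall>j\<ge>1. square_integrable (\<phi> j)) \<and>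
     (\<forall>j\<ge>1. \<forall>k\<ge>1. L2_inner (\<phi> j) (\<phi> k) = (if j = k then 1 else 0)) \<and>
     (\<forall>f. square_integrable f \<longrightarrow>
        (\<lambda>N. \<integral>x. (cmod (f x - (\<Sum>j=1..N. L2_inner f (\<phi> j) * \<phi> j x)))\<^sup>2 \<partial>lborel) \<longlonglongrightarrow> 0)"


section \<open>Differential operators with polynomial coefficients\<close>

text \<open>In \<open>c \<alpha> \<beta>\<close> the index \<open>\<alpha>\<close> belongs to the derivative and \<open>\<beta>\<close> to the monomial.\<close>

lemma finite_mindex_pairs:
  "finite {(\<alpha> :: 'n::finite mindex, \<beta> :: 'n mindex). mi_size \<alpha> + mi_size \<beta> \<le> m}"
proof -
  have le: "\<gamma> i \<le> mi_size \<gamma>" for \<gamma> :: "'n mindex" and i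
    unfolding mi_size_def by (rule member_le_sum) auto
  have "finite {\<gamma> :: 'n mindex. \<forall>i. \<gamma> i \<in> {..m}}"
    using finite_PiE[of "UNIV :: 'n set" "\<lambda>_. {..m}"] by (simp add: PiE_def Pi_def)
  moreover have "{(\<alpha>, \<beta>). mi_size \<alpha> + mi_size \<beta> \<le> m}
      \<subseteq> {\<gamma> :: 'n mindex. \<forall>i. \<gamma> i \<in> {..m}} \<times> {\<gamma> :: 'n mindex. \<forall>i. \<gamma> i \<in> {..m}}"
    using le by clarsimp (meson add_leD1 add_leD2 order_trans)
  ultimately show ?thesis
    by (meson finite_SigmaI finite_subset)
qed

definition D_x :: "'n::finite mindex \<Rightarrow> (real ^ 'n \<Rightarrow> complex) \<Rightarrow> real ^ 'n \<Rightarrow> complex" where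
  "D_x \<alpha> f x = (- \<i>) ^ mi_size \<alpha> * deriv_x \<alpha> f x"

definition diff_op ::
  "nat \<Rightarrow> ('n::finite mindex \<Rightarrow> 'n mindex \<Rightarrow> complex) \<Rightarrow> (real ^ 'n \<Rightarrow> complex) \<Rightarrow> real ^ 'n \<Rightarrow> complex" where
  "diff_op m c f x =
     (\<Sum>(\<alpha>, \<beta>) | mi_size \<alpha> + mi_size \<beta> \<le> m. c \<alpha> \<beta> * of_real (mi_power x \<beta>) * D_x \<alpha> f x)"

text \<open>
  The formal \<open>L\<^sup>2\<close>-adjoint: multiplication by \<open>x\<^sup>\<beta>\<close> and \<open>D\<^sup>\<alpha>\<close> are formally self-adjoint, so
  the adjoint of \<open>c x\<^sup>\<beta> D\<^sup>\<alpha>\<close> is \<open>f \<mapsto> D\<^sup>\<alpha> (cnj c x\<^sup>\<beta> f)\<close>.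
\<close>
definition diff_op_adj ::
  "nat \<Rightarrow> ('n::finite mindex \<Rightarrow> 'n mindex \<Rightarrow> complex) \<Rightarrow> (real ^ 'n \<Rightarrow> complex) \<Rightarrow> real ^ 'n \<Rightarrow> complex" where
  "diff_op_adj m c f x =
     (\<Sum>(\<alpha>, \<beta>) | mi_size \<alpha> + mi_size \<beta> \<le> m.
        D_x \<alpha> (\<lambda>y. cnj (c \<alpha> \<beta>) * of_real (mi_power y \<beta>) * f y) x)"

definition normal_op :: "nat \<Rightarrow> ('n::finite mindex \<Rightarrow> 'n mindex \<Rightarrow> complex) \<Rightarrow> bool" where
  "normal_op m c \<longleftrightarrow>
     (\<forall>f. smooth f \<longrightarrow> diff_op_adj m c (diff_op m c f) = diff_op m c (diff_op_adj m c f))"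

definition globally_elliptic :: "nat \<Rightarrow> ('n::finite mindex \<Rightarrow> 'n mindex \<Rightarrow> complex) \<Rightarrow> bool" where
  "globally_elliptic m c \<longleftrightarrow>
     (\<forall>(x :: real ^ 'n) (\<xi> :: real ^ 'n). (x, \<xi>) \<noteq> (0, 0) \<longrightarrow>
        (\<Sum>(\<alpha>, \<beta>) | mi_size \<alpha> + mi_size \<beta> = m.
           c \<alpha> \<beta> * of_real (mi_power x \<beta>) * of_real (mi_power \<xi> \<alpha>)) \<noteq> 0)"

end

theory Submission
  imports Defs "HOL-Real_Asymp.Real_Asymp"
begin

text \<open>
  Write \<open>\<theta>\<^sub>j(t) = \<integral> \<theta>(t, x) \<phi>\<^sub>j(x) dx\<close>. Moving \<open>P\<^sup>M\<close> from the eigenfunction \<open>\<phi>\<^sub>j\<close> to \<open>\<theta>\<close> by parts gives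
  \<open>|\<lambda>\<^sub>j|\<^sup>M |\<theta>\<^sub>j| \<le> C B\<^sup>M L\<^bsup>\<mu>L\<^esup>\<close> with \<open>L = mM + 2n\<close>: each of the \<open>mM\<close> multiplications by a coordinate
  and partial derivatives in \<open>P\<^sup>M\<close> costs a factor \<open>O(L\<^sup>\<mu>)\<close>, where \<open>\<mu> \<ge> 1/2\<close> absorbs the commutators
  \<open>[\<partial>\<^sub>i, x\<^sub>i] = 1\<close>. Since \<open>|\<lambda>\<^sub>j| \<ge> c j\<^bsup>m/2n\<^esup>\<close>, the best \<open>M\<close> gives decay \<open>exp (- \<epsilon> j\<^bsup>1/(2n\<mu>)\<^esup>)\<close> of the
  Gevrey norm of \<open>\<theta>\<^sub>j\<close>, which beats the growth of \<open>a\<^sub>j\<close>, so that the series converges absolutely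
  with a bound by any of the norms of \<open>\<theta>\<close>. The formula for \<open>a\<^sub>j\<close> is orthonormality.
\<close>

section \<open>Smooth functions\<close>

text \<open>The obstacle is to bound P^M without expanding it into monomials.
  \<open>mixed_bound R N K f\<close> measures all weighted derivatives up to order N on one
  geometric scale R, so that each coordinate or derivative spends one order and a factor
  \<open>2 * R\<close>. Test functions of level A satisfy it with
  \<open>R = max 1 A * L powr \<mu>\<close> up to order L; of these L orders mM go into P^M, and the
  remaining 2n buy decay like an integrable weight. With y = j^(1/(2n\<mu>)) the eigenvalues grow
  like y^(m\<mu>), and one application of P costs a constant times L^(m\<mu>). If L is a small
  multiple of y, each of the M applications therefore gains a factor 1/e over |\<lambda>_j|. The
  rate \<epsilon> depends on A, which is why the bound on a_j is assumed for every \<epsilon>. The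
  estimate is linear in the norm of \<theta>, so it gives convergence and continuity together, and
  it applies to each t-derivative of \<theta> with the same constants, which yields the Gevrey norm
  with h = A. The pairing is bilinear, so P is moved as its transpose and not as its
  adjoint.\<close>

lemma has_derivative_along_line:
  assumes D: "(f has_derivative D) (at (x + s *\<^sub>R b))"
  shows "((\<lambda>s. f (x + s *\<^sub>R b)) has_vector_derivative D b) (at s)"
proof -
  have "((\<lambda>s. x + s *\<^sub>R b) has_derivative (\<lambda>r. r *\<^sub>R b)) (at s)"
    by (auto intro!: derivative_eq_intros)
  from has_derivative_compose[OF this D]
  show ?thesis using D by (simp add: has_vector_derivative_def linear_cmul has_derivative_linear)
qed

lemma partial_deriv_eq:
  assumes "(f has_derivative D) (at x)"
  shows "partial_deriv b f x = D b"
  unfolding partial_deriv_def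
  by (rule vector_derivative_at) (use has_derivative_along_line[of f D x 0 b] assms in simp)

lemma differentiable_on_UNIV_D:
  "f differentiable_on UNIV \<Longrightarrow> \<exists>D. (f has_derivative D) (at x)"
  by (auto simp: differentiable_on_def differentiable_def)

lemma has_vector_derivative_partial_deriv:
  assumes "f differentiable_on UNIV"
  shows "((\<lambda>s. f (x + s *\<^sub>R b)) has_vector_derivative partial_deriv b f (x + s *\<^sub>R b)) (at s within S)"
proof -
  obtain D where D: "(f has_derivative D) (at (x + s *\<^sub>R b))"
    using differentiable_on_UNIV_D[OF assms] by blast
  show ?thesis
    using has_derivative_along_line[OF D]
    by (simp add: partial_deriv_eq[OF D] has_vector_derivative_at_within)
qed

text \<open>The mean value inequality in the direction a: once its expected linear part is
  subtracted, \<open>r \<mapsto> f (x + s *\<^sub>R b + r *\<^sub>R a) - f (x + r *\<^sub>R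
  a)\<close> has a derivative of size at most e s on [0, s]. Of the second derivatives, only the
  derivative of \<open>partial_deriv a f\<close> at the single point x enters.\<close>

lemma second_difference:
  fixes f :: "'a::real_normed_vector \<Rightarrow> 'b::real_normed_vector"
  assumes f: "f differentiable_on UNIV"
    and D: "(partial_deriv a f has_derivative D) (at x)"
    and e: "e > 0"
  shows "\<exists>d>0. \<forall>s. 0 < s \<and> s < d \<longrightarrow>
    norm (f (x + s *\<^sub>R a + s *\<^sub>R b) - f (x + s *\<^sub>R a) - f (x + s *\<^sub>R b) + f x - s\<^sup>2 *\<^sub>R D b) \<le> e * s\<^sup>2"
proof -
  \<comment> \<open>\<open>s * c\<close> bounds both displacements \<open>?v\<close> and
    \<open>?w\<close>; the factor 2 in \<open>e'\<close> pays for the two expansions of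
    \<open>partial_deriv a f\<close>, at \<open>x + ?v\<close> and at \<open>x + ?w\<close>.\<close>
  define c where "c = norm a + norm b + 1"
  have c: "c > 0" by (simp add: c_def add_nonneg_pos)
  define e' where "e' = e / (2 * c)"
  have e': "e' > 0" using e c by (simp add: e'_def)
  have lin: "linear D" using D by (rule has_derivative_linear)
  obtain d where d: "d > 0" "\<And>y. norm (y - x) < d \<Longrightarrow>
      norm (partial_deriv a f y - partial_deriv a f x - D (y - x)) \<le> e' * norm (y - x)"
    using D e' unfolding has_derivative_at_alt by blast
  have "norm (f (x + s *\<^sub>R a + s *\<^sub>R b) - f (x + s *\<^sub>R a) - f (x + s *\<^sub>R b) + f x - s\<^sup>2 *\<^sub>R D b) \<le> e * s\<^sup>2"
    if s: "0 < s" "s < d / c" for s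
  proof -
    define g where "g r = f ((x + s *\<^sub>R b) + r *\<^sub>R a) - f (x + r *\<^sub>R a) - r *\<^sub>R (s *\<^sub>R D b)" for r
    define g' where "g' r = partial_deriv a f ((x + s *\<^sub>R b) + r *\<^sub>R a) - partial_deriv a f (x + r *\<^sub>R a) - s *\<^sub>R D b" for r
    have "(g has_vector_derivative g' r) (at r within S)" for r S
      unfolding g_def g'_def
      by (intro has_vector_derivative_diff has_vector_derivative_partial_deriv f)
        (auto intro!: derivative_eq_intros simp: has_vector_derivative_def)
    then have g: "(g has_derivative (\<lambda>h. h *\<^sub>R g' r)) (at r within S)" for r S
      by (simp add: has_vector_derivative_def)
    have bnd: "norm (g' r) \<le> e * s" if r: "r \<in> {0..s}" for r
    proof -
      let ?v = "s *\<^sub>R b + r *\<^sub>R a" and ?w = "r *\<^sub>R a"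
      have n: "norm ?w \<le> s * c" "norm ?v \<le> s * c"
      proof -
        have "norm ?w \<le> s * norm a" using r by (auto intro!: mult_right_mono)
        also have "\<dots> \<le> s * c" using s by (intro mult_left_mono) (auto simp: c_def)
        finally show "norm ?w \<le> s * c" .
        have "norm ?v \<le> s * norm b + r * norm a"
          using r s by (intro order_trans[OF norm_triangle_ineq]) auto
        also have "\<dots> \<le> s * norm b + s * norm a" using r by (auto intro!: mult_right_mono)
        finally show "norm ?v \<le> s * c" using s by (simp add: c_def algebra_simps)
      qed
      have sc: "s * c < d" using s c by (simp add: field_simps)
      have 1: "norm (partial_deriv a f (x + ?v) - partial_deriv a f x - D ?v) \<le> e' * norm ?v"
        using d(2)[of "x + ?v"] n sc by simp
      have 2: "norm (partial_deriv a f (x + ?w) - partial_deriv a f x - D ?w) \<le> e' * norm ?w"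
        using d(2)[of "x + ?w"] n sc by simp
      have "g' r = (partial_deriv a f (x + ?v) - partial_deriv a f x - D ?v)
          - (partial_deriv a f (x + ?w) - partial_deriv a f x - D ?w)"
        by (simp add: g'_def linear_add[OF lin] linear_cmul[OF lin] algebra_simps)
      then have "norm (g' r) \<le> e' * norm ?v + e' * norm ?w"
        using norm_triangle_le_diff[OF add_mono[OF 1 2]] by simp
      also have "\<dots> \<le> e' * (s * c) + e' * (s * c)"
        using n e' by (intro add_mono mult_left_mono) auto
      also have "\<dots> = e * s" using c by (simp add: e'_def)
      finally show ?thesis .
    qed
    have "norm (g s - g 0) \<le> (e * s) * norm (s - 0)"
    proof (rule differentiable_bound[of "{0..s}" g "\<lambda>r h. h *\<^sub>R g' r"])
      show "onorm (\<lambda>h. h *\<^sub>R g' r) \<le> e * s" if "r \<in> {0..s}" for r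
        using bnd[OF that] by (intro onorm_le) (simp add: mult.commute[of "e * s"] mult_left_mono)
    qed (use s g in auto)
    then show ?thesis using s
      by (simp add: g_def power2_eq_square algebra_simps)
  qed
  then show ?thesis using d(1) c by (intro exI[of _ "d / c"]) auto
qed

text \<open>The second difference is symmetric in a and b, so s^2 times \<open>A b\<close> and s^2
  times \<open>B a\<close> both approximate it up to s^2 e/2; then divide by s^2.\<close>

lemma partial_deriv_commute:
  fixes f :: "'a::real_normed_vector \<Rightarrow> 'b::real_normed_vector"
  assumes f: "f differentiable_on UNIV"
    and a: "partial_deriv a f differentiable_on UNIV"
    and b: "partial_deriv b f differentiable_on UNIV"
  shows "partial_deriv a (partial_deriv b f) x = partial_deriv b (partial_deriv a f) x"
proof -
  obtain A where A: "(partial_deriv a f has_derivative A) (at x)"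
    using differentiable_on_UNIV_D[OF a] by blast
  obtain B where B: "(partial_deriv b f has_derivative B) (at x)"
    using differentiable_on_UNIV_D[OF b] by blast
  have "norm (A b - B a) \<le> e" if e: "e > 0" for e
  proof -
    obtain d1 where d1: "d1 > 0" "\<And>s. 0 < s \<Longrightarrow> s < d1 \<Longrightarrow>
      norm (f (x + s *\<^sub>R a + s *\<^sub>R b) - f (x + s *\<^sub>R a) - f (x + s *\<^sub>R b) + f x - s\<^sup>2 *\<^sub>R A b) \<le> e/2 * s\<^sup>2"
      using second_difference[OF f A, of "e/2" b] e by auto
    obtain d2 where d2: "d2 > 0" "\<And>s. 0 < s \<Longrightarrow> s < d2 \<Longrightarrow>
      norm (f (x + s *\<^sub>R b + s *\<^sub>R a) - f (x + s *\<^sub>R b) - f (x + s *\<^sub>R a) + f x - s\<^sup>2 *\<^sub>R B a) \<le> e/2 * s\<^sup>2"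
      using second_difference[OF f B, of "e/2" a] e by auto
    define s where "s = min d1 d2 / 2"
    have s: "0 < s" "s < d1" "s < d2" using d1(1) d2(1) by (auto simp: s_def)
    have "s\<^sup>2 *\<^sub>R (A b - B a) =
      (f (x + s *\<^sub>R b + s *\<^sub>R a) - f (x + s *\<^sub>R b) - f (x + s *\<^sub>R a) + f x - s\<^sup>2 *\<^sub>R B a) -
      (f (x + s *\<^sub>R a + s *\<^sub>R b) - f (x + s *\<^sub>R a) - f (x + s *\<^sub>R b) + f x - s\<^sup>2 *\<^sub>R A b)"
      by (simp add: algebra_simps)
    then have "norm (s\<^sup>2 *\<^sub>R (A b - B a)) \<le> e/2 * s\<^sup>2 + e/2 * s\<^sup>2"
      using norm_triangle_le_diff[OF add_mono[OF d2(2) d1(2)], of s s] s by simp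
    then have "s\<^sup>2 * norm (A b - B a) \<le> s\<^sup>2 * e" by (simp add: mult.commute)
    then show ?thesis using s by simp
  qed
  then have "norm (A b - B a) = 0"
    by (meson dense not_le norm_ge_zero order_antisym_conv less_le_not_le)
  then show ?thesis by (simp add: partial_deriv_eq[OF A] partial_deriv_eq[OF B])
qed

section \<open>Closure properties of smooth functions\<close>

lemma smooth_differentiable: "smooth f \<Longrightarrow> f differentiable_on UNIV"
  unfolding smooth_def by (metis empty_subsetI empty_set foldr.simps(1) id_apply)

lemma smooth_continuous: "smooth f \<Longrightarrow> continuous_on UNIV f"
  by (intro differentiable_imp_continuous_on smooth_differentiable)

lemma smooth_partial_deriv:
  assumes "smooth f" "b \<in> Basis" shows "smooth (partial_deriv b f)"
  unfolding smooth_def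
proof (intro allI impI)
  fix bs :: "'a list" assume "set bs \<subseteq> Basis"
  then show "foldr partial_deriv bs (partial_deriv b f) differentiable_on UNIV"
    using assms(1)[unfolded smooth_def, rule_format, of "bs @ [b]"] assms(2) by simp
qed

text \<open>Smoothness is the largest property that implies differentiability and passes to partial
  derivatives in basis directions. The closure lemmas then only have to exhibit an invariant set F,
  which avoids Leibniz formulas for iterated derivatives.\<close>

lemma smooth_coinduct:
  assumes "f \<in> F" "\<And>f. f \<in> F \<Longrightarrow> f differentiable_on UNIV"
    "\<And>f b. f \<in> F \<Longrightarrow> b \<in> Basis \<Longrightarrow> partial_deriv b f \<in> F"
  shows "smooth f"
proof -
  have "foldr partial_deriv bs f \<in> F" if "set bs \<subseteq> Basis" for bs
    using that by (induction bs) (auto simp: assms)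
  then show ?thesis by (auto simp: smooth_def assms)
qed

lemma partial_deriv_add:
  assumes "f differentiable_on UNIV" "g differentiable_on UNIV"
  shows "partial_deriv b (\<lambda>x. f x + g x) = (\<lambda>x. partial_deriv b f x + partial_deriv b g x)"
proof
  fix x
  obtain D E where D: "(f has_derivative D) (at x)" and E: "(g has_derivative E) (at x)"
    using assms[THEN differentiable_on_UNIV_D] by blast
  show "partial_deriv b (\<lambda>x. f x + g x) x = partial_deriv b f x + partial_deriv b g x"
    by (simp add: partial_deriv_eq[OF has_derivative_add[OF D E]] partial_deriv_eq[OF D] partial_deriv_eq[OF E])
qed

lemma partial_deriv_mult:
  fixes f g :: "'a::real_normed_vector \<Rightarrow> 'b::real_normed_field"
  assumes "f differentiable_on UNIV" "g differentiable_on UNIV"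
  shows "partial_deriv b (\<lambda>x. f x * g x) = (\<lambda>x. f x * partial_deriv b g x + partial_deriv b f x * g x)"
proof
  fix x
  obtain D E where D: "(f has_derivative D) (at x)" and E: "(g has_derivative E) (at x)"
    using assms[THEN differentiable_on_UNIV_D] by blast
  show "partial_deriv b (\<lambda>x. f x * g x) x = f x * partial_deriv b g x + partial_deriv b f x * g x"
    by (simp add: partial_deriv_eq[OF has_derivative_mult[OF D E]] partial_deriv_eq[OF D] partial_deriv_eq[OF E])
qed

lemma partial_deriv_const: "partial_deriv b (\<lambda>x. c) = (\<lambda>x. 0)"
  by (simp add: partial_deriv_def fun_eq_iff)

lemma partial_deriv_cmult:
  fixes f :: "'a::real_normed_vector \<Rightarrow> 'b::real_normed_field"
  assumes "f differentiable_on UNIV"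
  shows "partial_deriv b (\<lambda>x. c * f x) = (\<lambda>x. c * partial_deriv b f x)"
  using partial_deriv_mult[of "\<lambda>x. c" f b] assms by (simp add: partial_deriv_const)

lemma smooth_const: "smooth (\<lambda>x. c)"
  by (rule smooth_coinduct[of _ "range (\<lambda>c x. c)"]) (auto simp: partial_deriv_const)

lemma smooth_add:
  assumes "smooth f" "smooth g" shows "smooth (\<lambda>x. f x + g x)"
  by (rule smooth_coinduct[of _ "{(\<lambda>x. f x + g x) | f g. smooth f \<and> smooth g}"])
    (use assms in \<open>auto simp: partial_deriv_add smooth_differentiable\<close>,
     blast intro: smooth_partial_deriv)

lemma smooth_cmult:
  fixes f :: "'a::euclidean_space \<Rightarrow> 'b::real_normed_field"
  assumes "smooth f" shows "smooth (\<lambda>x. c * f x)"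
  by (rule smooth_coinduct[of _ "{(\<lambda>x. c * f x) | f. smooth f}"])
    (use assms in \<open>auto simp: partial_deriv_cmult smooth_differentiable\<close>,
     blast intro: smooth_partial_deriv)

lemma differentiable_coordinate:
  "(\<lambda>x::real^'n. of_real (x $ i) :: complex) differentiable_on UNIV"
  unfolding differentiable_on_def
  by (auto intro!: bounded_linear_imp_differentiable
      bounded_linear_compose[OF bounded_linear_of_real bounded_linear_vec_nth])

lemma partial_deriv_coordinate:
  "partial_deriv (axis j 1) (\<lambda>x::real^'n. of_real (x $ i) :: complex) = (\<lambda>x. if i = j then 1 else 0)"
proof
  fix x :: "real^'n"
  have "((\<lambda>x::real^'n. of_real (x $ i) :: complex) has_derivative (\<lambda>x. of_real (x $ i))) (at x)"
    by (intro bounded_linear_imp_has_derivative bounded_linear_compose[OF bounded_linear_of_real] bounded_linear_vec_nth)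
  from partial_deriv_eq[OF this, of "axis j 1"]
  show "partial_deriv (axis j 1) (\<lambda>x::real^'n. of_real (x $ i) :: complex) x = (if i = j then 1 else 0)"
    by (auto simp: axis_def)
qed

lemma partial_deriv_coordinate_mult:
  fixes f :: "real^'n \<Rightarrow> complex"
  assumes "f differentiable_on UNIV"
  shows "partial_deriv (axis j 1) (\<lambda>x. of_real (x $ i) * f x) =
    (\<lambda>x. of_real (x $ i) * partial_deriv (axis j 1) f x + (if i = j then 1 else 0) * f x)"
  by (simp add: partial_deriv_mult[OF differentiable_coordinate assms] partial_deriv_coordinate)

lemma smooth_coordinate_mult:
  fixes f :: "real^'n \<Rightarrow> complex"
  assumes "smooth f" shows "smooth (\<lambda>x. of_real (x $ i) * f x)"
\<comment> \<open>Differentiating \<open>of_real (x $ i) * f x\<close> leaves an additional term, f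
  or 0; the summand g makes the set closed under this.\<close>
proof (rule smooth_coinduct[of _ "{(\<lambda>x. of_real (x $ i) * f x + g x) | f g. smooth f \<and> smooth g}"])
  let ?F = "{(\<lambda>x. complex_of_real (x $ i) * f x + g x) | f g. smooth f \<and> smooth g}"
  have d: "(\<lambda>x. complex_of_real (x $ i) * f x) differentiable_on UNIV" if "smooth f" for f
    by (intro differentiable_on_mult differentiable_coordinate smooth_differentiable that)
  show "(\<lambda>x. of_real (x $ i) * f x) \<in> ?F"
    unfolding mem_Collect_eq
    by (intro exI[of _ f] exI[of _ "\<lambda>x. 0"]) (simp add: assms smooth_const)
  fix h :: "real^'n \<Rightarrow> complex" assume "h \<in> ?F"
  then obtain f g where h: "h = (\<lambda>x. of_real (x $ i) * f x + g x)" and fg: "smooth f" "smooth g" by auto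
  show "h differentiable_on UNIV"
    unfolding h by (intro differentiable_on_add d fg smooth_differentiable)
  fix b :: "real^'n" assume b: "b \<in> Basis"
  then obtain j where j: "b = axis j 1" by (auto simp: Basis_vec_def)
  have "partial_deriv b h = (\<lambda>x. of_real (x $ i) * partial_deriv b f x +
      ((if i = j then 1 else 0) * f x + partial_deriv b g x))"
    unfolding h j
    by (simp add: partial_deriv_add d fg smooth_differentiable partial_deriv_coordinate_mult add.assoc)
  then show "partial_deriv b h \<in> ?F"
    unfolding mem_Collect_eq
    by (intro exI conjI) (assumption | intro smooth_add smooth_cmult smooth_partial_deriv b fg)+
qed

lemma smooth_funpow_partial_deriv:
  "smooth f \<Longrightarrow> b \<in> Basis \<Longrightarrow> smooth ((partial_deriv b ^^ k) f)"
  by (induction k) (auto intro: smooth_partial_deriv)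

lemma partial_deriv_smooth_commute:
  assumes "smooth f" "a \<in> Basis" "b \<in> Basis"
  shows "partial_deriv a (partial_deriv b f) = partial_deriv b (partial_deriv a f)"
  by (rule ext, rule partial_deriv_commute) (auto intro!: smooth_differentiable smooth_partial_deriv assms)

lemma partial_deriv_funpow_commute:
  assumes "smooth f" "a \<in> Basis" "b \<in> Basis"
  shows "(partial_deriv a ^^ k) (partial_deriv b f) = partial_deriv b ((partial_deriv a ^^ k) f)"
  by (induction k) (simp_all add: partial_deriv_smooth_commute smooth_funpow_partial_deriv assms)

section \<open>Derivatives of multi-order\<close>

lemma smooth_foldr_partial_deriv:
  assumes "smooth f" "\<And>i. e i \<in> Basis"
  shows "smooth (foldr (\<lambda>i. partial_deriv (e i) ^^ \<beta> i) is f)"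
  by (induction "is") (auto intro: smooth_funpow_partial_deriv assms)

text \<open>\<open>mi_deriv\<close> uses one unspecified enumeration, so facts about it are proved
  for all of them.\<close>

lemma mindex_enumeration:
  fixes P :: "'n::finite list \<Rightarrow> bool"
  assumes "\<And>is. distinct is \<Longrightarrow> set is = UNIV \<Longrightarrow> P is"
  shows "P (SOME is. distinct is \<and> set is = (UNIV :: 'n set))"
  by (rule someI2_ex) (use finite_distinct_list[of "UNIV :: 'n set"] assms in auto)

lemma mi_deriv_zero: "mi_deriv e (\<lambda>i. 0) f = f"
proof -
  have "foldr (\<lambda>i. partial_deriv (e i) ^^ (0::nat)) is f = f" for "is" by (induction "is") auto
  then show ?thesis by (simp add: mi_deriv_def)
qed

text \<open>The new derivative appears at the place of i in the enumeration; symmetry of second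
  derivatives carries it inwards past the others. With \<open>mindex_induct\<close> this permits
  induction on multi-indices without looking at the enumeration again.\<close>

lemma mi_deriv_Suc:
  assumes f: "smooth f" and e: "\<And>i. e i \<in> Basis"
  shows "mi_deriv e (\<beta>(i := Suc (\<beta> i))) f = mi_deriv e \<beta> (partial_deriv (e i) f)"
proof -
  have *: "foldr (\<lambda>k. partial_deriv (e k) ^^ \<gamma> k) is (partial_deriv (e i) f) =
      partial_deriv (e i) (foldr (\<lambda>k. partial_deriv (e k) ^^ \<gamma> k) is f)" for "is" \<gamma>
    by (induction "is") (auto simp: partial_deriv_funpow_commute smooth_foldr_partial_deriv f e)
  have notin: "foldr (\<lambda>k. partial_deriv (e k) ^^ (\<beta>(i := Suc (\<beta> i))) k) is f =
      foldr (\<lambda>k. partial_deriv (e k) ^^ \<beta> k) is f" if "i \<notin> set is" for "is"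
    using that by (induction "is") auto
  have "foldr (\<lambda>k. partial_deriv (e k) ^^ (\<beta>(i := Suc (\<beta> i))) k) is f =
      foldr (\<lambda>k. partial_deriv (e k) ^^ \<beta> k) is (partial_deriv (e i) f)"
    if "distinct is" "i \<in> set is" for "is"
    using that
  proof (induction "is")
    case (Cons j js)
    show ?case
    proof (cases "j = i")
      case True
      then show ?thesis using Cons.prems
        by (simp add: notin * partial_deriv_funpow_commute smooth_foldr_partial_deriv f e
            fun_upd_same del: fun_upd_apply)
    next
      case False
      then show ?thesis using Cons by simp
    qed
  qed simp
  then show ?thesis unfolding mi_deriv_def
    by (rule mindex_enumeration) auto
qed

section \<open>Mixed weights and derivatives\<close>

lemma mindex_induct [case_names zero Suc]:
  fixes \<beta> :: "'n::finite mindex"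
  assumes "P (\<lambda>i. 0)" "\<And>\<beta> i. P \<beta> \<Longrightarrow> P (\<beta>(i := Suc (\<beta> i)))"
  shows "P \<beta>"
proof (induction "mi_size \<beta>" arbitrary: \<beta> rule: less_induct)
  case less
  show ?case
  proof (cases "\<exists>i. \<beta> i \<noteq> 0")
    case True
    then obtain i where i: "\<beta> i \<noteq> 0" by blast
    have "mi_size (\<beta>(i := \<beta> i - 1)) < mi_size \<beta>"
      unfolding mi_size_def by (rule sum_strict_mono_ex1) (use i in auto)
    from assms(2)[OF less[OF this], of i] show ?thesis using i by simp
  next
    case False
    then have "\<beta> = (\<lambda>i. 0)" by auto
    then show ?thesis using assms(1) by simp
  qed
qed

lemma mi_size_zero [simp]: "mi_size (\<lambda>i. 0) = 0"
  by (simp add: mi_size_def)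

lemma mi_size_Suc [simp]: "mi_size (\<beta>(i := Suc (\<beta> i))) = Suc (mi_size \<beta>)"
  unfolding mi_size_def by (subst (1 2) sum.remove[of _ i]) auto

lemma mi_size_decr: "\<beta> i > 0 \<Longrightarrow> Suc (mi_size (\<beta>(i := \<beta> i - 1))) = mi_size \<beta>"
  using mi_size_Suc[of "\<beta>(i := \<beta> i - 1)" i] by simp

lemma le_mi_size: "\<beta> i \<le> mi_size \<beta>"
  unfolding mi_size_def by (rule member_le_sum) auto

lemma mi_power_zero [simp]: "mi_power x (\<lambda>i. 0) = 1"
  by (simp add: mi_power_def)

lemma mi_power_Suc [simp]: "mi_power x (\<alpha>(i := Suc (\<alpha> i))) = x $ i * mi_power x \<alpha>"
  unfolding mi_power_def by (subst (1 2) prod.remove[of _ i]) auto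

lemma axis_Basis: "axis i (1::real) \<in> Basis"
  by (simp add: axis_in_Basis_iff)

lemma mi_deriv_add:
  assumes "smooth f" "smooth g" and e: "\<And>i. e i \<in> Basis"
  shows "mi_deriv e \<beta> (\<lambda>x. f x + g x) = (\<lambda>x. mi_deriv e \<beta> f x + mi_deriv e \<beta> g x)"
  using assms(1,2)
proof (induction \<beta> arbitrary: f g rule: mindex_induct)
  case (Suc \<beta> i)
  then show ?case
    by (simp add: mi_deriv_Suc e smooth_add partial_deriv_add smooth_differentiable smooth_partial_deriv
        del: fun_upd_apply)
qed (simp add: mi_deriv_zero)

lemma mi_deriv_cmult:
  fixes f :: "'a::euclidean_space \<Rightarrow> 'b::real_normed_field"
  assumes "smooth f" and e: "\<And>i. e i \<in> Basis"
  shows "mi_deriv e \<beta> (\<lambda>x. c * f x) = (\<lambda>x. c * mi_deriv e \<beta> f x)"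
  using assms(1)
proof (induction \<beta> arbitrary: f rule: mindex_induct)
  case (Suc \<beta> i)
  then show ?case
    by (simp add: mi_deriv_Suc e smooth_cmult partial_deriv_cmult smooth_differentiable smooth_partial_deriv
        del: fun_upd_apply)
qed (simp add: mi_deriv_zero)

lemma deriv_x_Suc:
  "smooth f \<Longrightarrow> deriv_x (\<beta>(i := Suc (\<beta> i))) f = deriv_x \<beta> (partial_deriv (axis i 1) f)"
  by (intro mi_deriv_Suc) (simp_all add: axis_Basis)

text \<open>The commutator of the derivative of order \<beta> with x_i is \<beta>_i times the
  derivative with one order less in i. If \<open>\<beta> i = 0\<close>, the truncated subtraction is
  harmless because the factor vanishes.\<close>

lemma deriv_x_coordinate_mult:
  assumes "smooth f"
  shows "deriv_x \<beta> (\<lambda>x. of_real (x $ i) * f x) =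
    (\<lambda>x. of_real (x $ i) * deriv_x \<beta> f x + of_nat (\<beta> i) * deriv_x (\<beta>(i := \<beta> i - 1)) f x)"
  using assms
proof (induction \<beta> arbitrary: f rule: mindex_induct)
  case (Suc \<beta> j)
  let ?df = "partial_deriv (axis j 1) f"
  have df: "smooth ?df" using Suc.prems by (simp add: smooth_partial_deriv axis_Basis)
  have "deriv_x (\<beta>(j := Suc (\<beta> j))) (\<lambda>x. of_real (x $ i) * f x) =
      deriv_x \<beta> (\<lambda>x. of_real (x $ i) * ?df x + (if i = j then 1 else 0) * f x)"
    using Suc.prems
    by (simp add: deriv_x_Suc axis_Basis smooth_coordinate_mult smooth_differentiable
        partial_deriv_coordinate_mult del: fun_upd_apply)
  also have "\<dots> = (\<lambda>x. of_real (x $ i) * deriv_x \<beta> ?df x + of_nat (\<beta> i) * deriv_x (\<beta>(i := \<beta> i - 1)) ?df x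
      + (if i = j then 1 else 0) * deriv_x \<beta> f x)"
    using Suc.prems df
    by (simp add: mi_deriv_add mi_deriv_cmult smooth_coordinate_mult smooth_cmult axis_Basis Suc.IH
        del: fun_upd_apply)
  also have "\<dots> = (\<lambda>x. of_real (x $ i) * deriv_x (\<beta>(j := Suc (\<beta> j))) f x +
      of_nat ((\<beta>(j := Suc (\<beta> j))) i) * deriv_x ((\<beta>(j := Suc (\<beta> j)))(i := (\<beta>(j := Suc (\<beta> j))) i - 1)) f x)"
  proof (cases "i = j")
    case True
    have 1: "of_nat (\<beta> i) * deriv_x (\<beta>(i := \<beta> i - 1)) ?df x = of_nat (\<beta> i) * deriv_x \<beta> f x" for x
      using deriv_x_Suc[OF Suc.prems, where \<beta> = "\<beta>(i := \<beta> i - 1)" and i = i] True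
      by (cases "\<beta> i = 0") auto
    have 2: "(\<beta>(j := Suc (\<beta> j)))(i := (\<beta>(j := Suc (\<beta> j))) i - 1) = \<beta>"
      using True by auto
    show ?thesis
      unfolding 1 2 using True Suc.prems
      by (simp add: fun_upd_same deriv_x_Suc algebra_simps del: fun_upd_apply)
  next
    case False
    then have 2: "(\<beta>(j := Suc (\<beta> j)))(i := (\<beta>(j := Suc (\<beta> j))) i - 1) =
        (\<beta>(i := \<beta> i - 1))(j := Suc ((\<beta>(i := \<beta> i - 1)) j))"
      by (simp add: fun_upd_twist)
    show ?thesis
      unfolding 2 deriv_x_Suc[OF Suc.prems] using False by simp
  qed
  finally show ?case .
qed (simp add: mi_deriv_zero)

text \<open>The useful range is \<open>N \<le> R\<^sup>2\<close>: a commutator lowers the order by 2 and costs a factor at most \<open>N\<close>.\<close>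
definition mixed_bound :: "real \<Rightarrow> nat \<Rightarrow> real \<Rightarrow> (real^'n::finite \<Rightarrow> complex) \<Rightarrow> bool" where
  "mixed_bound R N K f \<longleftrightarrow> smooth f \<and> (\<forall>\<alpha> \<beta> x. mi_size \<alpha> + mi_size \<beta> \<le> N \<longrightarrow>
     \<bar>mi_power x \<alpha>\<bar> * cmod (deriv_x \<beta> f x) \<le> K * R ^ (mi_size \<alpha> + mi_size \<beta>))"

lemma mixed_bound_smooth: "mixed_bound R N K f \<Longrightarrow> smooth f"
  by (simp add: mixed_bound_def)

lemma mixed_boundD:
  "mixed_bound R N K f \<Longrightarrow> mi_size \<alpha> + mi_size \<beta> \<le> N \<Longrightarrow>
    \<bar>mi_power x \<alpha>\<bar> * cmod (deriv_x \<beta> f x) \<le> K * R ^ (mi_size \<alpha> + mi_size \<beta>)"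
  by (simp add: mixed_bound_def)

lemma mixed_bound_nonneg:
  assumes "mixed_bound R N K f" shows "K \<ge> 0"
  using order_trans[OF norm_ge_zero, of "f 0" K]
    mixed_boundD[OF assms, of "\<lambda>i. 0" "\<lambda>i. 0" 0]
  by (simp add: mi_deriv_zero)

lemma mixed_bound_weaken:
  assumes "mixed_bound R N K f" "N' \<le> N" "K \<le> K'" "R \<ge> 0"
  shows "mixed_bound R N' K' f"
  unfolding mixed_bound_def
proof (intro conjI allI impI)
  fix \<alpha> \<beta> :: "'a mindex" and x :: "real^'a"
  assume "mi_size \<alpha> + mi_size \<beta> \<le> N'"
  then have "\<bar>mi_power x \<alpha>\<bar> * cmod (deriv_x \<beta> f x) \<le> K * R ^ (mi_size \<alpha> + mi_size \<beta>)"
    using assms by (intro mixed_boundD[OF assms(1)]) auto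
  also have "\<dots> \<le> K' * R ^ (mi_size \<alpha> + mi_size \<beta>)"
    using assms by (intro mult_right_mono) auto
  finally show "\<bar>mi_power x \<alpha>\<bar> * cmod (deriv_x \<beta> f x) \<le> K' * R ^ (mi_size \<alpha> + mi_size \<beta>)" .
qed (use assms in \<open>simp add: mixed_bound_def\<close>)

lemma mixed_bound_add:
  assumes "mixed_bound R N K f" "mixed_bound R N K' g"
  shows "mixed_bound R N (K + K') (\<lambda>x. f x + g x)"
  unfolding mixed_bound_def
proof (intro conjI allI impI)
  show "smooth (\<lambda>x. f x + g x)"
    using assms by (intro smooth_add mixed_bound_smooth)
  fix \<alpha> \<beta> :: "'a mindex" and x :: "real^'a"
  assume s: "mi_size \<alpha> + mi_size \<beta> \<le> N"
  have "\<bar>mi_power x \<alpha>\<bar> * cmod (deriv_x \<beta> (\<lambda>x. f x + g x) x) \<le>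
      \<bar>mi_power x \<alpha>\<bar> * (cmod (deriv_x \<beta> f x) + cmod (deriv_x \<beta> g x))"
    using assms by (intro mult_left_mono)
      (auto simp: mi_deriv_add mixed_bound_smooth axis_Basis intro: norm_triangle_ineq)
  also have "\<dots> \<le> (K + K') * R ^ (mi_size \<alpha> + mi_size \<beta>)"
    using mixed_boundD[OF assms(1) s, of x] mixed_boundD[OF assms(2) s, of x]
    by (simp add: algebra_simps)
  finally show "\<bar>mi_power x \<alpha>\<bar> * cmod (deriv_x \<beta> (\<lambda>x. f x + g x) x) \<le> (K + K') * R ^ (mi_size \<alpha> + mi_size \<beta>)" .
qed

lemma mixed_bound_cmult:
  assumes "mixed_bound R N K f"
  shows "mixed_bound R N (cmod c * K) (\<lambda>x. c * f x)"
  unfolding mixed_bound_def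
proof (intro conjI allI impI)
  show "smooth (\<lambda>x. c * f x)"
    using assms by (intro smooth_cmult mixed_bound_smooth)
  fix \<alpha> \<beta> :: "'a mindex" and x :: "real^'a"
  assume s: "mi_size \<alpha> + mi_size \<beta> \<le> N"
  show "\<bar>mi_power x \<alpha>\<bar> * cmod (deriv_x \<beta> (\<lambda>x. c * f x) x) \<le> cmod c * K * R ^ (mi_size \<alpha> + mi_size \<beta>)"
    using mult_left_mono[OF mixed_boundD[OF assms s, of x], of "cmod c"] assms
    by (simp add: mi_deriv_cmult mixed_bound_smooth axis_Basis norm_mult mult_ac)
qed

lemma mixed_bound_zero: "mixed_bound R N 0 (\<lambda>x. 0)"
proof -
  have "mi_deriv e \<beta> (\<lambda>x::real^'a. 0 :: complex) = (\<lambda>x. 0)" if "\<And>i. e i \<in> Basis" for e :: "'a \<Rightarrow> real^'a" and \<beta>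
    using mi_deriv_cmult[of "\<lambda>x. 0" e \<beta> 0] that by (simp add: smooth_const)
  then show ?thesis by (simp add: mixed_bound_def smooth_const axis_Basis)
qed

lemma mixed_bound_sum:
  assumes "finite A" "\<And>a. a \<in> A \<Longrightarrow> mixed_bound R N (K a) (f a)"
  shows "mixed_bound R N (\<Sum>a\<in>A. K a) (\<lambda>x. \<Sum>a\<in>A. f a x)"
  using assms by (induction A rule: finite_induct) (auto intro: mixed_bound_zero mixed_bound_add)

text \<open>In the Leibniz formula the first term raises the monomial and costs one R. The second
  has one derivative less and the factor \<open>\<beta> i \<le> N \<le> R\<^sup>2\<close>, hence
  again a single R in total. Together they make the price \<open>2 * R\<close> of one
  coordinate.\<close>

lemma mixed_bound_coordinate_mult:
  assumes f: "mixed_bound R (Suc N) K f" and R: "R \<ge> 1" "real N \<le> R\<^sup>2"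
  shows "mixed_bound R N (2 * R * K) (\<lambda>x. of_real (x $ i) * f x)"
  unfolding mixed_bound_def
proof (intro conjI allI impI)
  note sm = mixed_bound_smooth[OF f]
  have K: "K \<ge> 0" by (rule mixed_bound_nonneg[OF f])
  show "smooth (\<lambda>x. of_real (x $ i) * f x)" by (rule smooth_coordinate_mult[OF sm])
  fix \<alpha> \<beta> :: "'a mindex" and x :: "real^'a"
  assume s: "mi_size \<alpha> + mi_size \<beta> \<le> N"
  let ?n = "mi_size \<alpha> + mi_size \<beta>" and ?\<beta>' = "\<beta>(i := \<beta> i - 1)"
  have 1: "\<bar>mi_power x \<alpha>\<bar> * cmod (of_real (x $ i) * deriv_x \<beta> f x) \<le> K * R ^ Suc ?n"
    using mixed_boundD[OF f, of "\<alpha>(i := Suc (\<alpha> i))" \<beta> x] s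
    by (simp add: norm_mult abs_mult mult_ac del: fun_upd_apply)
  have 2: "\<bar>mi_power x \<alpha>\<bar> * cmod (of_nat (\<beta> i) * deriv_x ?\<beta>' f x) \<le> K * R ^ Suc ?n"
  proof (cases "\<beta> i = 0")
    case False
    have sz: "Suc (mi_size ?\<beta>') = mi_size \<beta>" using False by (intro mi_size_decr) simp
    have "real (\<beta> i) \<le> R\<^sup>2" using le_mi_size[of \<beta> i] s R(2) by linarith
    then have "real (\<beta> i) * (\<bar>mi_power x \<alpha>\<bar> * cmod (deriv_x ?\<beta>' f x)) \<le>
        R\<^sup>2 * (K * R ^ (mi_size \<alpha> + mi_size ?\<beta>'))"
      using s sz by (intro mult_mono mixed_boundD[OF f]) auto
    also have "\<dots> = K * R ^ Suc ?n"
      by (simp flip: sz add: power2_eq_square mult_ac)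
    finally show ?thesis by (simp add: norm_mult mult_ac)
  qed (use K R in simp)
  have "\<bar>mi_power x \<alpha>\<bar> * cmod (deriv_x \<beta> (\<lambda>x. of_real (x $ i) * f x) x) \<le>
      \<bar>mi_power x \<alpha>\<bar> * (cmod (of_real (x $ i) * deriv_x \<beta> f x) + cmod (of_nat (\<beta> i) * deriv_x ?\<beta>' f x))"
    unfolding deriv_x_coordinate_mult[OF sm] by (intro mult_left_mono norm_triangle_ineq) auto
  also have "\<dots> \<le> K * R ^ Suc ?n + K * R ^ Suc ?n"
    unfolding distrib_left using 1 2 by (rule add_mono)
  finally show "\<bar>mi_power x \<alpha>\<bar> * cmod (deriv_x \<beta> (\<lambda>x. of_real (x $ i) * f x) x) \<le> 2 * R * K * R ^ ?n"
    by (simp add: mult_ac)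
qed

text \<open>The factor 2 is slack: it makes a derivative as expensive as a coordinate, so that P
  costs a pure power of \<open>2 * R\<close>.\<close>

lemma mixed_bound_partial_deriv:
  assumes f: "mixed_bound R (Suc N) K f" and R: "R \<ge> 1"
  shows "mixed_bound R N (2 * R * K) (partial_deriv (axis i 1) f)"
  unfolding mixed_bound_def
proof (intro conjI allI impI)
  note sm = mixed_bound_smooth[OF f]
  have K: "K \<ge> 0" by (rule mixed_bound_nonneg[OF f])
  show "smooth (partial_deriv (axis i 1) f)" by (rule smooth_partial_deriv[OF sm axis_Basis])
  fix \<alpha> \<beta> :: "'a mindex" and x :: "real^'a"
  assume s: "mi_size \<alpha> + mi_size \<beta> \<le> N"
  have "\<bar>mi_power x \<alpha>\<bar> * cmod (deriv_x \<beta> (partial_deriv (axis i 1) f) x) \<le> K * R ^ Suc (mi_size \<alpha> + mi_size \<beta>)"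
    using mixed_boundD[OF f, of \<alpha> "\<beta>(i := Suc (\<beta> i))" x] s
    by (simp add: deriv_x_Suc[OF sm] del: fun_upd_apply)
  also have "\<dots> \<le> 2 * R * K * R ^ (mi_size \<alpha> + mi_size \<beta>)"
    using mult_nonneg_nonneg[OF K, of "R ^ Suc (mi_size \<alpha> + mi_size \<beta>)"] R by (simp add: mult_ac)
  finally show "\<bar>mi_power x \<alpha>\<bar> * cmod (deriv_x \<beta> (partial_deriv (axis i 1) f) x) \<le>
      2 * R * K * R ^ (mi_size \<alpha> + mi_size \<beta>)" .
qed

lemma mixed_bound_monomial_mult:
  assumes "mixed_bound R (N + mi_size \<beta>) K f" "R \<ge> 1" "real (N + mi_size \<beta>) \<le> R\<^sup>2"
  shows "mixed_bound R N ((2 * R) ^ mi_size \<beta> * K) (\<lambda>x. of_real (mi_power x \<beta>) * f x)"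
  using assms(1,3)
proof (induction \<beta> arbitrary: f K rule: mindex_induct)
  case (Suc \<beta> i)
  have "mixed_bound R (N + mi_size \<beta>) (2 * R * K) (\<lambda>x. of_real (x $ i) * f x)"
    using Suc.prems assms(2) by (intro mixed_bound_coordinate_mult) (auto simp del: fun_upd_apply)
  from Suc.IH[OF this] Suc.prems show ?case by (simp add: mult_ac del: fun_upd_apply)
qed simp

lemma mixed_bound_deriv_x:
  assumes "mixed_bound R (N + mi_size \<alpha>) K f" "R \<ge> 1"
  shows "mixed_bound R N ((2 * R) ^ mi_size \<alpha> * K) (deriv_x \<alpha> f)"
  using assms(1)
proof (induction \<alpha> arbitrary: f K rule: mindex_induct)
  case (Suc \<alpha> i)
  have "mixed_bound R (N + mi_size \<alpha>) (2 * R * K) (partial_deriv (axis i 1) f)"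
    using Suc.prems assms(2) by (intro mixed_bound_partial_deriv) (auto simp del: fun_upd_apply)
  from Suc.IH[OF this] Suc.prems show ?case
    by (simp add: deriv_x_Suc mixed_bound_smooth axis_Basis mult_ac del: fun_upd_apply)
qed (simp add: mi_deriv_zero)

section \<open>The transposed operator and its powers\<close>

text \<open>The formal transpose for the bilinear pairing: \<open>D\<^sup>\<alpha>\<close> becomes \<open>(-1)\<^bsup>|\<alpha>|\<^esup> D\<^sup>\<alpha>\<close>.\<close>
definition transposed_op ::
  "nat \<Rightarrow> ('n::finite mindex \<Rightarrow> 'n mindex \<Rightarrow> complex) \<Rightarrow> (real ^ 'n \<Rightarrow> complex) \<Rightarrow> real ^ 'n \<Rightarrow> complex" where
  "transposed_op m c f x = (\<Sum>(\<alpha>, \<beta>) | mi_size \<alpha> + mi_size \<beta> \<le> m.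
     c \<alpha> \<beta> * \<i> ^ mi_size \<alpha> * deriv_x \<alpha> (\<lambda>y. of_real (mi_power y \<beta>) * f y) x)"

definition coeff_sum :: "nat \<Rightarrow> ('n::finite mindex \<Rightarrow> 'n mindex \<Rightarrow> complex) \<Rightarrow> real" where
  "coeff_sum m c = (\<Sum>(\<alpha>, \<beta>) | mi_size \<alpha> + mi_size \<beta> \<le> m. cmod (c \<alpha> \<beta>))"

text \<open>The summand of (\<alpha>, \<beta>) spends at most m orders and as many factors
  \<open>2 * R\<close>; since these are at least 1, the m-th power serves for all summands.\<close>

lemma mixed_bound_transposed_op:
  assumes f: "mixed_bound R (N + m) K f" and R: "R \<ge> 1" "real (N + m) \<le> R\<^sup>2"
  shows "mixed_bound R N (coeff_sum m c * (2 * R) ^ m * K) (transposed_op m c f)"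
proof -
  have K: "K \<ge> 0" by (rule mixed_bound_nonneg[OF f])
  let ?A = "{(\<alpha> :: 'a mindex, \<beta> :: 'a mindex). mi_size \<alpha> + mi_size \<beta> \<le> m}"
  have summand: "mixed_bound R N (cmod (c \<alpha> \<beta>) * ((2 * R) ^ m * K))
      (\<lambda>x. c \<alpha> \<beta> * \<i> ^ mi_size \<alpha> * deriv_x \<alpha> (\<lambda>y. of_real (mi_power y \<beta>) * f y) x)"
    if s: "mi_size \<alpha> + mi_size \<beta> \<le> m" for \<alpha> \<beta>
  proof -
    have "mixed_bound R ((N + mi_size \<alpha>) + mi_size \<beta>) K f"
      by (rule mixed_bound_weaken[OF f]) (use s R in auto)
    then have "mixed_bound R N ((2 * R) ^ mi_size \<alpha> * ((2 * R) ^ mi_size \<beta> * K))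
        (deriv_x \<alpha> (\<lambda>y. of_real (mi_power y \<beta>) * f y))"
      by (intro mixed_bound_deriv_x mixed_bound_monomial_mult) (use R s in auto)
    then have "mixed_bound R N ((2 * R) ^ m * K) (deriv_x \<alpha> (\<lambda>y. of_real (mi_power y \<beta>) * f y))"
    proof (rule mixed_bound_weaken)
      have "(2 * R) ^ (mi_size \<alpha> + mi_size \<beta>) * K \<le> (2 * R) ^ m * K"
        using R K s by (intro mult_right_mono power_increasing) auto
      then show "(2 * R) ^ mi_size \<alpha> * ((2 * R) ^ mi_size \<beta> * K) \<le> (2 * R) ^ m * K"
        by (simp add: power_add mult_ac)
    qed (use R in auto)
    from mixed_bound_cmult[OF this, of "c \<alpha> \<beta> * \<i> ^ mi_size \<alpha>"] show ?thesis
      by (simp add: norm_mult norm_power)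
  qed
  have "mixed_bound R N (\<Sum>p\<in>?A. case p of (\<alpha>, \<beta>) \<Rightarrow> cmod (c \<alpha> \<beta>) * ((2 * R) ^ m * K))
      (\<lambda>x. \<Sum>p\<in>?A. (case p of (\<alpha>, \<beta>) \<Rightarrow> \<lambda>x. c \<alpha> \<beta> * \<i> ^ mi_size \<alpha> * deriv_x \<alpha> (\<lambda>y. of_real (mi_power y \<beta>) * f y) x) x)"
    by (rule mixed_bound_sum[OF finite_mindex_pairs]) (use summand in auto)
  moreover have "(\<Sum>p\<in>?A. case p of (\<alpha>, \<beta>) \<Rightarrow> cmod (c \<alpha> \<beta>) * ((2 * R) ^ m * K)) = coeff_sum m c * (2 * R) ^ m * K"
    by (simp add: coeff_sum_def sum_distrib_right sum_distrib_left case_prod_unfold mult_ac)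
  moreover have "(\<lambda>x. \<Sum>p\<in>?A. (case p of (\<alpha>, \<beta>) \<Rightarrow> \<lambda>x. c \<alpha> \<beta> * \<i> ^ mi_size \<alpha> * deriv_x \<alpha> (\<lambda>y. of_real (mi_power y \<beta>) * f y) x) x)
      = transposed_op m c f"
    by (simp add: transposed_op_def case_prod_unfold fun_eq_iff)
  ultimately show ?thesis by simp
qed

lemma mixed_bound_transposed_op_funpow:
  assumes "mixed_bound R (N + m * M) K f" "R \<ge> 1" "real (N + m * M) \<le> R\<^sup>2"
  shows "mixed_bound R N ((coeff_sum m c * (2 * R) ^ m) ^ M * K) ((transposed_op m c ^^ M) f)"
  using assms(1,3)
proof (induction M arbitrary: N)
  case (Suc M)
  have "mixed_bound R (N + m) ((coeff_sum m c * (2 * R) ^ m) ^ M * K) ((transposed_op m c ^^ M) f)"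
    using Suc.prems by (intro Suc.IH) (simp_all add: add.assoc)
  then have "mixed_bound R N (coeff_sum m c * (2 * R) ^ m * ((coeff_sum m c * (2 * R) ^ m) ^ M * K))
      (transposed_op m c ((transposed_op m c ^^ M) f))"
  proof (rule mixed_bound_transposed_op)
    have "real (N + m) \<le> real (N + m * Suc M)" by simp
    then show "real (N + m) \<le> R\<^sup>2" using Suc.prems(2) by (rule order_trans)
  qed (rule assms(2))
  then show ?case by (simp add: mult_ac)
qed simp

section \<open>Integration of rapidly decreasing functions\<close>

text \<open>Dominated convergence for the normalised remainder \<open>Q\<close> of the first-order
  expansion: it tends to 0 pointwise, and the mean value inequality bounds it by
  \<open>2 * v x\<close>.\<close>

lemma has_vector_derivative_integral:
  fixes F :: "real \<Rightarrow> 'a \<Rightarrow> complex"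
  assumes der: "\<And>s x. s \<in> {s0-1..s0+1} \<Longrightarrow> ((\<lambda>s. F s x) has_vector_derivative F' s x) (at s)"
    and int: "\<And>s. s \<in> {s0-1..s0+1} \<Longrightarrow> integrable M (F s)"
    and meas: "F' s0 \<in> borel_measurable M"
    and bnd: "\<And>s x. s \<in> {s0-1..s0+1} \<Longrightarrow> norm (F' s x) \<le> v x"
    and v: "integrable M v"
  shows "((\<lambda>s. \<integral>x. F s x \<partial>M) has_vector_derivative (\<integral>x. F' s0 x \<partial>M)) (at s0)"
proof -
  let ?S = "{s0-1..s0+1}"
  define Q where "Q y x = (1 / norm (y - s0)) *\<^sub>R (F y x - (F s0 x + (y - s0) *\<^sub>R F' s0 x))" for y x
  have int': "integrable M (F' s0)"
    by (rule Bochner_Integration.integrable_bound[OF v meas])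
      (use bnd[of s0] in \<open>auto intro!: AE_I2 order_trans[OF _ abs_ge_self]\<close>)
  have Q: "((\<lambda>y. Q y x) \<longlongrightarrow> 0) (at s0 within ?S)" for x
    using der[of s0 x, THEN has_vector_derivative_at_within[of _ _ _ ?S]]
    unfolding has_vector_derivative_def has_derivative_within Q_def by auto
  have lip: "norm (F y x - F s0 x) \<le> v x * norm (y - s0)" if "y \<in> ?S" for x y
  proof (rule differentiable_bound[of ?S "\<lambda>s. F s x" "\<lambda>s h. h *\<^sub>R F' s x"])
    show "onorm (\<lambda>h. h *\<^sub>R F' s x) \<le> v x" if "s \<in> ?S" for s
      using bnd[OF that, of x] by (intro onorm_le) (simp add: mult.commute[of "v x"] mult_left_mono)
    show "((\<lambda>s. F s x) has_derivative (\<lambda>h. h *\<^sub>R F' s x)) (at s within ?S)" if "s \<in> ?S" for s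
      using der[OF that, of x, THEN has_vector_derivative_at_within] by (simp add: has_vector_derivative_def)
  qed (use that in auto)
  have dom: "norm (Q y x) \<le> 2 * v x" if y: "y \<in> ?S - {s0}" for x y
  proof -
    have "norm (F y x - (F s0 x + (y - s0) *\<^sub>R F' s0 x)) \<le> v x * norm (y - s0) + v x * norm (y - s0)"
      unfolding diff_diff_add[symmetric]
    proof (rule norm_triangle_le_diff, rule add_mono)
      show "norm (F y x - F s0 x) \<le> v x * norm (y - s0)" using lip y by auto
      show "norm ((y - s0) *\<^sub>R F' s0 x) \<le> v x * norm (y - s0)"
        using mult_right_mono[OF bnd[of s0 x], of "norm (y - s0)"] by (simp add: mult.commute)
    qed
    moreover have "norm (Q y x) = norm (F y x - (F s0 x + (y - s0) *\<^sub>R F' s0 x)) / norm (y - s0)"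
      by (simp add: Q_def)
    ultimately show ?thesis using y by (simp add: divide_le_eq)
  qed
  have intQ: "integrable M (Q y)" if "y \<in> ?S" for y
    unfolding Q_def using int[OF that] int[of s0] int' by auto
  \<comment> \<open>Dominated convergence concerns sequences, so the limit is tested along sequences
    in \<open>?S - {s0}\<close>.\<close>
  have QI: "((\<lambda>y. \<integral>x. Q y x \<partial>M) \<longlongrightarrow> 0) (at s0 within ?S)"
    unfolding tendsto_at_iff_sequentially comp_def
  proof (intro allI impI)
    fix X assume X: "\<forall>i. X i \<in> ?S - {s0}" "X \<longlonglongrightarrow> s0"
    have "(\<lambda>i. \<integral>x. Q (X i) x \<partial>M) \<longlonglongrightarrow> (\<integral>x. 0 \<partial>M)"
    proof (rule integral_dominated_convergence[where w = "\<lambda>x. 2 * v x"])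
      show "AE x in M. (\<lambda>i. Q (X i) x) \<longlonglongrightarrow> 0"
        using Q X unfolding tendsto_at_iff_sequentially comp_def by auto
      show "AE x in M. norm (Q (X i) x) \<le> 2 * v x" for i
        using dom X by auto
      show "Q (X i) \<in> borel_measurable M" for i
        using intQ[of "X i"] X by auto
    qed (use v in auto)
    then show "(\<lambda>i. \<integral>x. Q (X i) x \<partial>M) \<longlonglongrightarrow> 0" by simp
  qed
  have "((\<lambda>y. (1 / norm (y - s0)) *\<^sub>R ((\<integral>x. F y x \<partial>M) - ((\<integral>x. F s0 x \<partial>M) + (y - s0) *\<^sub>R (\<integral>x. F' s0 x \<partial>M)))) \<longlongrightarrow> 0)
    (at s0 within ?S)"
  proof (rule Lim_transform_within[OF QI zero_less_one])
    fix y assume "y \<in> ?S"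
    then show "(\<integral>x. Q y x \<partial>M) = (1 / norm (y - s0)) *\<^sub>R ((\<integral>x. F y x \<partial>M) - ((\<integral>x. F s0 x \<partial>M) + (y - s0) *\<^sub>R (\<integral>x. F' s0 x \<partial>M)))"
      unfolding Q_def using int[of y] int[of s0] int' by simp
  qed
  then have "((\<lambda>s. \<integral>x. F s x \<partial>M) has_vector_derivative (\<integral>x. F' s0 x \<partial>M)) (at s0 within ?S)"
    unfolding has_vector_derivative_def has_derivative_within
    by (auto intro: bounded_linear_scaleR_left)
  moreover have "at s0 within ?S = at s0"
    by (rule at_within_interior) (simp add: interior_atLeastAtMost_real)
  ultimately show ?thesis by simp
qed

section \<open>An integrable weight and pointwise decay\<close>

lemma nn_integral_inverse_1_plus_square:
  "(\<integral>\<^sup>+x. ennreal (1 / (1 + x\<^sup>2)) \<partial>lborel) < \<infinity>"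
proof -
  let ?f = "\<lambda>x::real. 1 / (1 + x\<^sup>2)"
  have pos: "(\<integral>\<^sup>+x. ennreal (?f x) * indicator {0..} x \<partial>lborel) = ennreal (pi / 2)"
    using nn_integral_FTC_atLeast[of ?f 0 arctan "pi/2"]
    by (simp add: tendsto_arctan_at_top inverse_eq_divide[symmetric] DERIV_arctan)
  \<comment> \<open>The reflection at 0 reduces this to the positive half-line, where
    \<open>arctan\<close> is a primitive.\<close>
  have "(\<integral>\<^sup>+x. ennreal (?f x) * indicator {..0} x \<partial>lborel) = ennreal (pi / 2)"
    by (subst nn_integral_real_affine[where c = "-1" and t = 0])
      (auto simp: pos[symmetric] intro!: nn_integral_cong split: split_indicator)
  then have "(\<integral>\<^sup>+x. ennreal (?f x) * indicator {0..} x + ennreal (?f x) * indicator {..0} x \<partial>lborel) < \<infinity>"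
    using pos by (simp add: nn_integral_add)
  moreover have "(\<integral>\<^sup>+x. ennreal (?f x) \<partial>lborel) \<le>
      (\<integral>\<^sup>+x. ennreal (?f x) * indicator {0..} x + ennreal (?f x) * indicator {..0} x \<partial>lborel)"
    by (rule nn_integral_mono) (auto split: split_indicator)
  ultimately show ?thesis by (rule le_less_trans[rotated])
qed

text \<open>A product over the coordinates, so that its integral factors into one-dimensional ones,
  while monomials of order at most 2n control its reciprocal.\<close>

definition weight :: "real^'n::finite \<Rightarrow> real" where
  "weight x = (\<Prod>i\<in>UNIV. 1 / (1 + (x $ i)\<^sup>2))"

lemma weight_pos: "weight x > 0"
  unfolding weight_def by (intro prod_pos) (auto intro!: divide_pos_pos add_pos_nonneg)

lemma weight_le_1: "weight x \<le> 1"
  unfolding weight_def by (intro prod_le_1) (auto simp: divide_le_eq_1 add_pos_nonneg add_nonneg_nonneg)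

lemma weight_measurable [measurable]: "weight \<in> borel_measurable borel"
  unfolding weight_def[abs_def] by measurable

lemma integrable_weight: "integrable lborel (weight :: real^'n::finite \<Rightarrow> real)"
proof (rule integrableI_nonneg)
  have inj: "inj (\<lambda>i::'n. axis i (1::real))" by (auto simp: inj_on_def axis_eq_axis)
  have B: "(Basis :: (real^'n) set) = range (\<lambda>i. axis i 1)" by (auto simp: Basis_vec_def)
  have "weight x = (\<Prod>b\<in>Basis. 1 / (1 + (x \<bullet> b)\<^sup>2))" for x :: "real^'n"
    unfolding B by (subst prod.reindex[OF inj]) (simp add: weight_def inner_axis)
  then have "(\<integral>\<^sup>+x. ennreal (weight x) \<partial>(lborel :: (real^'n) measure)) =
      (\<integral>\<^sup>+x. (\<Prod>b\<in>Basis. ennreal (1 / (1 + (x \<bullet> b)\<^sup>2))) \<partial>(lborel :: (real^'n) measure))"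
    by (simp add: prod_ennreal)
  also have "\<dots> = (\<Prod>b\<in>(Basis :: (real^'n) set). (\<integral>\<^sup>+x. ennreal (1 / (1 + x\<^sup>2)) \<partial>lborel))"
    by (rule nn_integral_lborel_prod) auto
  also have "\<dots> < \<infinity>"
    using nn_integral_inverse_1_plus_square by (simp add: power_less_top_ennreal)
  finally show "(\<integral>\<^sup>+x. ennreal (weight x) \<partial>(lborel :: (real^'n) measure)) < \<infinity>" .
qed (auto simp: weight_pos less_imp_le)

text \<open>Supplies one integrable majorant for all translates by at most 1, as needed when a
  translated integral is differentiated. The constant: 2(a+s)^2 + 2 - a^2 = (a+2s)^2 + 2(1-s^2)
  \<ge> 0 gives 1 + a^2 \<le> 3(1 + (a+s)^2).\<close>

lemma weight_shift:
  assumes "\<bar>s\<bar> \<le> 1" shows "weight (x + s *\<^sub>R axis i 1) \<le> 3 * weight x"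
proof -
  have *: "1 / (1 + (a + s)\<^sup>2) \<le> 3 * (1 / (1 + a\<^sup>2))" for a :: real
  proof -
    have "s\<^sup>2 \<le> 1" using assms by (simp add: abs_square_le_1)
    moreover have "0 \<le> (a + 2 * s)\<^sup>2" by simp
    ultimately have "a\<^sup>2 \<le> 2 * (a + s)\<^sup>2 + 2"
      by (simp add: power2_eq_square algebra_simps)
    then have "1 + a\<^sup>2 \<le> 3 * (1 + (a + s)\<^sup>2)"
      using zero_le_power2[of "a + s"] unfolding distrib_left by linarith
    then show ?thesis
      by (simp add: divide_simps add_pos_nonneg less_imp_neq[symmetric] add_nonneg_eq_0_iff)
  qed
  have "weight (x + s *\<^sub>R axis i 1) = 1 / (1 + (x $ i + s)\<^sup>2) * (\<Prod>j\<in>UNIV-{i}. 1 / (1 + (x $ j)\<^sup>2))"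
    unfolding weight_def by (subst prod.remove[of _ i]) (auto simp: axis_def intro!: prod.cong)
  also have "\<dots> \<le> 3 * (1 / (1 + (x $ i)\<^sup>2)) * (\<Prod>j\<in>UNIV-{i}. 1 / (1 + (x $ j)\<^sup>2))"
    by (intro mult_right_mono * prod_nonneg) auto
  also have "\<dots> = 3 * weight x"
    unfolding weight_def by (subst (2) prod.remove[of _ i]) auto
  finally show ?thesis .
qed

text \<open>Testing against the monomial that carries a square exactly in the coordinates larger than 1.\<close>
lemma mixed_bound_weight:
  fixes f :: "real^'n::finite \<Rightarrow> complex"
  assumes f: "mixed_bound R (2 * CARD('n)) K f" and R: "R \<ge> 1"
  shows "cmod (f x) \<le> 2 ^ CARD('n) * R ^ (2 * CARD('n)) * K * weight x"
proof -
  have K: "K \<ge> 0" by (rule mixed_bound_nonneg[OF f])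
  define \<alpha> where "\<alpha> = (\<lambda>i. if \<bar>x $ i\<bar> > 1 then 2 else (0::nat))"
  have sz: "mi_size \<alpha> \<le> 2 * CARD('n)"
    using sum_bounded_above[of UNIV \<alpha> 2] by (auto simp: mi_size_def \<alpha>_def mult.commute)
  have "1 / weight x = (\<Prod>i\<in>UNIV. 1 + (x $ i)\<^sup>2)"
    unfolding weight_def by (subst prod_dividef) simp
  also have "\<dots> \<le> (\<Prod>i\<in>UNIV. 2 * \<bar>x $ i ^ \<alpha> i\<bar>)"
  proof (rule prod_mono, rule conjI)
    fix i
    show "1 + (x $ i)\<^sup>2 \<le> 2 * \<bar>x $ i ^ \<alpha> i\<bar>"
    proof (cases "\<bar>x $ i\<bar> > 1")
      case True
      then have "1 \<le> (x $ i)\<^sup>2" using one_le_power[of "\<bar>x $ i\<bar>" 2] by simp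
      then show ?thesis using True by (simp add: \<alpha>_def)
    next
      case False
      then have "(x $ i)\<^sup>2 \<le> 1" by (simp add: abs_square_le_1)
      then show ?thesis using False by (simp add: \<alpha>_def)
    qed
  qed simp
  also have "\<dots> = 2 ^ CARD('n) * \<bar>mi_power x \<alpha>\<bar>"
    by (simp add: prod.distrib mi_power_def abs_prod)
  finally have w: "1 / weight x \<le> 2 ^ CARD('n) * \<bar>mi_power x \<alpha>\<bar>" .
  have "cmod (f x) = (1 / weight x * cmod (f x)) * weight x"
    using weight_pos[of x] by simp
  also have "\<dots> \<le> (2 ^ CARD('n) * \<bar>mi_power x \<alpha>\<bar> * cmod (f x)) * weight x"
    using w weight_pos[of x] by (intro mult_right_mono) auto
  also have "\<dots> \<le> (2 ^ CARD('n) * (K * R ^ mi_size \<alpha>)) * weight x"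
    using mixed_boundD[OF f, of \<alpha> "\<lambda>i. 0" x] sz weight_pos[of x]
    by (intro mult_right_mono) (auto simp: mi_deriv_zero)
  also have "\<dots> \<le> (2 ^ CARD('n) * (K * R ^ (2 * CARD('n)))) * weight x"
    using sz K R weight_pos[of x] by (intro mult_right_mono mult_left_mono power_increasing) auto
  finally show ?thesis by (simp add: mult_ac)
qed

section \<open>Rapidly decreasing functions\<close>

definition schwartz :: "(real^'n::finite \<Rightarrow> complex) \<Rightarrow> bool" where
  "schwartz f \<longleftrightarrow> (\<forall>N. \<exists>K. mixed_bound 1 N K f)"

text \<open>For a fixed order N all scales \<open>R \<ge> 1\<close> define the same class, with
  different constants K. The scale 1 in \<open>schwartz\<close> is thus a normalisation, and the
  scale can be adapted to conditions such as \<open>N \<le> R\<^sup>2\<close>.\<close>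

lemma schwartz_mixed_bound:
  assumes "schwartz f" "R \<ge> 1" shows "\<exists>K. mixed_bound R N K f"
proof -
  obtain K where K: "mixed_bound 1 N K f" using assms by (auto simp: schwartz_def)
  have "mixed_bound R N K f"
    unfolding mixed_bound_def
  proof (intro conjI allI impI)
    fix \<alpha> \<beta> :: "'a mindex" and x :: "real^'a"
    assume "mi_size \<alpha> + mi_size \<beta> \<le> N"
    then have "\<bar>mi_power x \<alpha>\<bar> * cmod (deriv_x \<beta> f x) \<le> K * 1"
      using mixed_boundD[OF K, of \<alpha> \<beta> x] by simp
    also have "\<dots> \<le> K * R ^ (mi_size \<alpha> + mi_size \<beta>)"
      using assms(2) mixed_bound_nonneg[OF K] by (intro mult_left_mono) auto
    finally show "\<bar>mi_power x \<alpha>\<bar> * cmod (deriv_x \<beta> f x) \<le> K * R ^ (mi_size \<alpha> + mi_size \<beta>)" .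
  qed (rule mixed_bound_smooth[OF K])
  then show ?thesis by blast
qed

lemma schwartzI:
  assumes "\<And>N. \<exists>R\<ge>1. \<exists>K. mixed_bound R N K f" shows "schwartz f"
  unfolding schwartz_def
proof
  fix N
  obtain R K where R: "R \<ge> 1" and K: "mixed_bound R N K f" using assms by blast
  have "mixed_bound 1 N (K * R ^ N) f"
    unfolding mixed_bound_def
  proof (intro conjI allI impI)
    fix \<alpha> \<beta> :: "'a mindex" and x :: "real^'a"
    assume s: "mi_size \<alpha> + mi_size \<beta> \<le> N"
    have "\<bar>mi_power x \<alpha>\<bar> * cmod (deriv_x \<beta> f x) \<le> K * R ^ (mi_size \<alpha> + mi_size \<beta>)"
      by (rule mixed_boundD[OF K s])
    also have "\<dots> \<le> K * R ^ N"
      using R mixed_bound_nonneg[OF K] s by (intro mult_left_mono power_increasing) auto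
    finally show "\<bar>mi_power x \<alpha>\<bar> * cmod (deriv_x \<beta> f x) \<le> K * R ^ N * 1 ^ (mi_size \<alpha> + mi_size \<beta>)" by simp
  qed (rule mixed_bound_smooth[OF K])
  then show "\<exists>K. mixed_bound 1 N K f" by blast
qed

text \<open>Passing through a scale with \<open>N + d \<le> R\<^sup>2\<close>, chosen for each N,
  turns the quantitative lemmas on \<open>mixed_bound\<close> into closure properties of
  \<open>schwartz\<close>.\<close>

lemma schwartz_transform:
  assumes "schwartz f"
    "\<And>N K R. R \<ge> 1 \<Longrightarrow> real (N + d) \<le> R\<^sup>2 \<Longrightarrow> mixed_bound R (N + d) K f \<Longrightarrow> \<exists>K'. mixed_bound R N K' g"
  shows "schwartz g"
proof (rule schwartzI)
  fix N
  define R where "R = real (N + d) + 1"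
  have R: "R \<ge> 1" "real (N + d) \<le> R\<^sup>2" by (auto simp: R_def power2_eq_square algebra_simps)
  with assms schwartz_mixed_bound[OF assms(1) R(1), of "N + d"]
  show "\<exists>R\<ge>1. \<exists>K. mixed_bound R N K g" by blast
qed

lemma schwartz_smooth: "schwartz f \<Longrightarrow> smooth f"
  by (auto simp: schwartz_def dest: mixed_bound_smooth)

lemma schwartz_measurable [measurable_dest]: "schwartz f \<Longrightarrow> f \<in> borel_measurable borel"
  by (intro borel_measurable_continuous_onI smooth_continuous schwartz_smooth)

lemma schwartz_monomial_mult: "schwartz f \<Longrightarrow> schwartz (\<lambda>x. of_real (mi_power x \<beta>) * f x)"
  by (erule schwartz_transform[where d = "mi_size \<beta>"]) (blast intro: mixed_bound_monomial_mult)

lemma schwartz_deriv_x: "schwartz f \<Longrightarrow> schwartz (deriv_x \<alpha> f)"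
  by (erule schwartz_transform[where d = "mi_size \<alpha>"]) (blast intro: mixed_bound_deriv_x)

lemma schwartz_partial_deriv: "schwartz f \<Longrightarrow> schwartz (partial_deriv (axis i 1) f)"
  by (erule schwartz_transform[where d = 1]) (metis Suc_eq_plus1 mixed_bound_partial_deriv)

lemma schwartz_transposed_op: "schwartz f \<Longrightarrow> schwartz (transposed_op m c f)"
  by (erule schwartz_transform[where d = m]) (blast intro: mixed_bound_transposed_op)

lemma schwartz_transposed_op_funpow: "schwartz f \<Longrightarrow> schwartz ((transposed_op m c ^^ M) f)"
  by (induction M) (auto intro: schwartz_transposed_op)

lemma schwartz_weight:
  fixes f :: "real^'n::finite \<Rightarrow> complex"
  assumes "schwartz f" shows "\<exists>C\<ge>0. \<forall>x. cmod (f x) \<le> C * weight x"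
proof -
  obtain K where "mixed_bound 1 (2 * CARD('n)) K f" using assms by (auto simp: schwartz_def)
  from mixed_bound_weight[OF this] mixed_bound_nonneg[OF this] show ?thesis
    by (intro exI[of _ "2 ^ CARD('n) * K"]) auto
qed

lemma schwartz_mult_weight:
  assumes "schwartz f" "schwartz g" shows "\<exists>C\<ge>0. \<forall>x. cmod (f x * g x) \<le> C * weight x"
proof -
  obtain A where A: "A \<ge> 0" "\<And>x. cmod (f x) \<le> A * weight x" using schwartz_weight[OF assms(1)] by blast
  obtain B where B: "B \<ge> 0" "\<And>x. cmod (g x) \<le> B * weight x" using schwartz_weight[OF assms(2)] by blast
  have "cmod (f x * g x) \<le> A * B * weight x" for x
  proof -
    have "cmod (f x * g x) \<le> (A * weight x) * (B * 1)"
      unfolding norm_mult using A B weight_le_1[of x] weight_pos[of x]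
      by (intro mult_mono order_trans[OF B(2)] mult_left_mono) auto
    then show ?thesis by (simp add: mult_ac)
  qed
  then show ?thesis using A B by (intro exI[of _ "A * B"]) auto
qed

lemma integrable_weight_bound:
  assumes "f \<in> borel_measurable borel" "\<And>x. cmod (f x) \<le> C * weight x"
  shows "integrable lborel f"
  by (rule Bochner_Integration.integrable_bound[OF integrable_mult_right[OF integrable_weight, of C]])
    (use assms in \<open>auto intro!: AE_I2 order_trans[OF _ abs_ge_self]\<close>)

lemma integrable_schwartz_mult:
  assumes "schwartz f" "schwartz g" shows "integrable lborel (\<lambda>x. f x * g x)"
proof -
  obtain C where "\<And>x. cmod (f x * g x) \<le> C * weight x" using schwartz_mult_weight[OF assms] by blast
  then show ?thesis
    using assms by (intro integrable_weight_bound[of _ C]) (auto intro!: borel_measurable_times schwartz_measurable)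
qed

section \<open>Integration by parts and the eigenvalue identity\<close>

text \<open>The integral of a translate does not depend on the translation.\<close>
lemma integral_partial_deriv_eq_0:
  fixes h :: "real^'n::finite \<Rightarrow> complex"
  assumes h: "h differentiable_on UNIV" "integrable lborel h"
    and d: "partial_deriv (axis i 1) h \<in> borel_measurable borel"
      "\<And>x. cmod (partial_deriv (axis i 1) h x) \<le> C * weight x"
  shows "(\<integral>x. partial_deriv (axis i 1) h x \<partial>lborel) = 0"
proof -
  let ?e = "axis i 1 :: real^'n"
  have C: "C \<ge> 0" using order_trans[OF norm_ge_zero d(2)[of 0]] weight_pos[of 0]
    by (metis less_le_not_le mult_less_0_iff not_le)
  have hm: "h \<in> borel_measurable borel"
    using h(1) by (intro borel_measurable_continuous_onI differentiable_imp_continuous_on)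
  have shift: "distr lborel borel (\<lambda>x. x + s *\<^sub>R ?e) = lborel" for s
  proof -
    have "(\<lambda>x. x + s *\<^sub>R ?e) = (+) (s *\<^sub>R ?e)" by (rule ext) (rule add.commute)
    then show ?thesis by (simp add: lborel_distr_plus)
  qed
  have "((\<lambda>s. \<integral>x. h (x + s *\<^sub>R ?e) \<partial>lborel) has_vector_derivative
      (\<integral>x. partial_deriv ?e h (x + 0 *\<^sub>R ?e) \<partial>lborel)) (at 0)"
  \<comment> \<open>For |s| \<le> 1 the derivatives of all translates lie below one integrable
    function, by \<open>weight_shift\<close>.\<close>
  proof (rule has_vector_derivative_integral[where v = "\<lambda>x. C * (3 * weight x)"])
    fix s :: real and x :: "real^'n" assume s: "s \<in> {0-1..0+1}"
    have "cmod (partial_deriv ?e h (x + s *\<^sub>R ?e)) \<le> C * weight (x + s *\<^sub>R ?e)" by (rule d)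
    also have "\<dots> \<le> C * (3 * weight x)" using C s by (intro mult_left_mono weight_shift) auto
    finally show "cmod (partial_deriv ?e h (x + s *\<^sub>R ?e)) \<le> C * (3 * weight x)" .
    show "((\<lambda>s. h (x + s *\<^sub>R ?e)) has_vector_derivative partial_deriv ?e h (x + s *\<^sub>R ?e)) (at s)"
      by (rule has_vector_derivative_partial_deriv[OF h(1)])
    have "integrable (distr lborel borel (\<lambda>x. x + s *\<^sub>R ?e)) h" using h(2) by (simp add: shift)
    then show "integrable lborel (\<lambda>x. h (x + s *\<^sub>R ?e))"
      by (subst (asm) integrable_distr_eq) (use hm in auto)
  qed (use d(1) integrable_weight in auto)
  moreover have "(\<integral>x. h (x + s *\<^sub>R ?e) \<partial>lborel) = (\<integral>x. h x \<partial>lborel)" for s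
    using integral_distr[of "\<lambda>x. x + s *\<^sub>R ?e" lborel borel h] hm by (simp add: shift)
  ultimately show ?thesis
    using vector_derivative_unique_at[OF _ has_vector_derivative_const] by simp
qed

lemma integral_by_parts_schwartz:
  assumes f: "schwartz f" and g: "schwartz g"
  shows "(\<integral>x. f x * partial_deriv (axis i 1) g x \<partial>lborel) = - (\<integral>x. partial_deriv (axis i 1) f x * g x \<partial>lborel)"
proof -
  let ?d = "partial_deriv (axis i 1)"
  note f' = schwartz_partial_deriv[OF f, of i] and g' = schwartz_partial_deriv[OF g, of i]
  have df: "f differentiable_on UNIV" "g differentiable_on UNIV"
    using f g by (auto intro: smooth_differentiable schwartz_smooth)
  have prod: "?d (\<lambda>x. f x * g x) = (\<lambda>x. f x * ?d g x + ?d f x * g x)"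
    using df by (rule partial_deriv_mult)
  obtain A where A: "\<And>x. cmod (f x * ?d g x) \<le> A * weight x" using schwartz_mult_weight[OF f g'] by blast
  obtain B where B: "\<And>x. cmod (?d f x * g x) \<le> B * weight x" using schwartz_mult_weight[OF f' g] by blast
  have "(\<integral>x. ?d (\<lambda>x. f x * g x) x \<partial>lborel) = 0"
  proof (rule integral_partial_deriv_eq_0)
    show "cmod (?d (\<lambda>x. f x * g x) x) \<le> (A + B) * weight x" for x
      unfolding prod distrib_right by (intro norm_triangle_le add_mono A B)
    show "?d (\<lambda>x. f x * g x) \<in> borel_measurable borel"
      unfolding prod using f g f' g'
      by (intro borel_measurable_add borel_measurable_times schwartz_measurable)
  qed (use df f g in \<open>auto intro: integrable_schwartz_mult differentiable_on_mult\<close>)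
  then show ?thesis
    using integrable_schwartz_mult[OF f g'] integrable_schwartz_mult[OF f' g]
    by (simp add: prod add_eq_0_iff2)
qed

lemma deriv_x_partial_deriv:
  assumes "smooth f"
  shows "deriv_x \<alpha> (partial_deriv (axis i 1) f) = partial_deriv (axis i 1) (deriv_x \<alpha> f)"
  using assms
proof (induction \<alpha> arbitrary: f rule: mindex_induct)
  case (Suc \<alpha> j)
  then show ?case
    by (simp add: deriv_x_Suc smooth_partial_deriv axis_Basis del: fun_upd_apply)
      (metis Suc.IH axis_Basis partial_deriv_smooth_commute smooth_partial_deriv)
qed (simp add: mi_deriv_zero)

lemma integral_by_parts_deriv_x:
  assumes "schwartz f" "schwartz g"
  shows "(\<integral>x. f x * deriv_x \<alpha> g x \<partial>lborel) = (-1) ^ mi_size \<alpha> * (\<integral>x. deriv_x \<alpha> f x * g x \<partial>lborel)"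
  using assms
proof (induction \<alpha> arbitrary: f g rule: mindex_induct)
  case (Suc \<alpha> i)
  have "(\<integral>x. f x * deriv_x (\<alpha>(i := Suc (\<alpha> i))) g x \<partial>lborel) =
      (-1) ^ mi_size \<alpha> * (\<integral>x. deriv_x \<alpha> f x * partial_deriv (axis i 1) g x \<partial>lborel)"
    using Suc.IH[OF Suc.prems(1) schwartz_partial_deriv[OF Suc.prems(2), of i]] Suc.prems
    by (simp add: deriv_x_Suc schwartz_smooth del: fun_upd_apply)
  also have "\<dots> = (-1) ^ Suc (mi_size \<alpha>) * (\<integral>x. deriv_x \<alpha> (partial_deriv (axis i 1) f) x * g x \<partial>lborel)"
    using Suc.prems
    by (simp add: integral_by_parts_schwartz schwartz_deriv_x deriv_x_partial_deriv schwartz_smooth)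
  finally show ?case
    using Suc.prems by (simp add: deriv_x_Suc schwartz_smooth del: fun_upd_apply)
qed (simp add: mi_deriv_zero)

lemma integral_diff_op:
  assumes f: "schwartz f" and g: "schwartz g"
  shows "(\<integral>x. f x * diff_op m c g x \<partial>lborel) = (\<integral>x. transposed_op m c f x * g x \<partial>lborel)"
proof -
  let ?A = "{(\<alpha> :: 'a mindex, \<beta> :: 'a mindex). mi_size \<alpha> + mi_size \<beta> \<le> m}"
  have "(\<integral>x. f x * diff_op m c g x \<partial>lborel) =
      (\<integral>x. (\<Sum>(\<alpha>, \<beta>)\<in>?A. c \<alpha> \<beta> * (- \<i>) ^ mi_size \<alpha> * ((of_real (mi_power x \<beta>) * f x) * deriv_x \<alpha> g x)) \<partial>lborel)"
    by (simp add: diff_op_def D_x_def sum_distrib_left case_prod_unfold mult_ac)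
  also have "\<dots> = (\<Sum>(\<alpha>, \<beta>)\<in>?A. c \<alpha> \<beta> * (- \<i>) ^ mi_size \<alpha> *
      (\<integral>x. (of_real (mi_power x \<beta>) * f x) * deriv_x \<alpha> g x \<partial>lborel))"
    unfolding case_prod_unfold
    by (subst Bochner_Integration.integral_sum)
      (use f g in \<open>auto intro!: integrable_mult_right integrable_schwartz_mult[where g = "deriv_x _ g"]
        schwartz_monomial_mult schwartz_deriv_x simp del: mult.assoc\<close>)
  also have "\<dots> = (\<Sum>(\<alpha>, \<beta>)\<in>?A. c \<alpha> \<beta> * \<i> ^ mi_size \<alpha> *
      (\<integral>x. deriv_x \<alpha> (\<lambda>y. of_real (mi_power y \<beta>) * f y) x * g x \<partial>lborel))"
  proof (intro sum.cong refl, clarify)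
    fix \<alpha> \<beta> :: "'a mindex"
    \<comment> \<open>The sign from integration by parts turns the factor
      \<open>(- \<i>) ^ mi_size \<alpha>\<close> of \<open>D_x\<close> into the
      \<open>\<i> ^ mi_size \<alpha>\<close> of \<open>transposed_op\<close>.\<close>
    have "(- \<i>) ^ k * (-1) ^ k = \<i> ^ k" for k by (simp flip: power_mult_distrib)
    then show "c \<alpha> \<beta> * (- \<i>) ^ mi_size \<alpha> * (\<integral>x. (of_real (mi_power x \<beta>) * f x) * deriv_x \<alpha> g x \<partial>lborel) =
        c \<alpha> \<beta> * \<i> ^ mi_size \<alpha> * (\<integral>x. deriv_x \<alpha> (\<lambda>y. of_real (mi_power y \<beta>) * f y) x * g x \<partial>lborel)"
      unfolding integral_by_parts_deriv_x[OF schwartz_monomial_mult[OF f] g]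
      by (metis (no_types, lifting) mult.assoc)
  qed
  also have "\<dots> = (\<integral>x. (\<Sum>(\<alpha>, \<beta>)\<in>?A. c \<alpha> \<beta> * \<i> ^ mi_size \<alpha> *
      (deriv_x \<alpha> (\<lambda>y. of_real (mi_power y \<beta>) * f y) x * g x)) \<partial>lborel)"
    unfolding case_prod_unfold
    by (subst Bochner_Integration.integral_sum)
      (use f g in \<open>auto intro!: integrable_mult_right integrable_schwartz_mult[where g = g]
        schwartz_monomial_mult schwartz_deriv_x simp del: mult.assoc\<close>)
  also have "\<dots> = (\<integral>x. transposed_op m c f x * g x \<partial>lborel)"
    by (simp add: transposed_op_def sum_distrib_right case_prod_unfold mult.assoc)
  finally show ?thesis .
qed

lemma integral_eigenfunction:
  assumes f: "schwartz f" and g: "schwartz g" and ev: "\<And>x. diff_op m c g x = l * g x"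
  shows "l ^ M * (\<integral>x. f x * g x \<partial>lborel) = (\<integral>x. (transposed_op m c ^^ M) f x * g x \<partial>lborel)"
proof (induction M)
  case (Suc M)
  let ?f = "(transposed_op m c ^^ M) f"
  have "(\<integral>x. (transposed_op m c ^^ Suc M) f x * g x \<partial>lborel) = (\<integral>x. ?f x * diff_op m c g x \<partial>lborel)"
    using integral_diff_op[OF schwartz_transposed_op_funpow[OF f] g] by simp
  also have "\<dots> = (\<integral>x. l * (?f x * g x) \<partial>lborel)" by (simp add: ev mult_ac)
  also have "\<dots> = l ^ Suc M * (\<integral>x. f x * g x \<partial>lborel)" by (simp add: Suc.IH[symmetric] mult.assoc)
  finally show ?case by simp
qed simp

section \<open>Decay of the coefficients\<close>

text \<open>With \<open>L = 2n + mM \<approx> \<delta>y\<close> and \<open>\<delta>\<close> small, each of the \<open>M\<close> factors on the right of the hypothesis is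
  at most \<open>l / e\<close>, because \<open>L\<^bsup>m\<mu>\<^esup>\<close> is a small multiple of \<open>y\<^bsup>m\<mu>\<^esup>\<close>.\<close>
lemma exponential_decay_of_power_bounds:
  fixes \<mu> A S \<kappa> W Y0 :: real and m n :: nat
  assumes \<mu>: "\<mu> > 0" and m: "m > 0" and n: "n > 0" and A: "A \<ge> 1" and S: "S \<ge> 0"
    and \<kappa>: "\<kappa> > 0" and W: "W \<ge> 0"
  obtains \<epsilon> C where "\<epsilon> > 0" "C > 0"
    "\<And>y l I K. 0 \<le> y \<Longrightarrow> 0 \<le> I \<Longrightarrow> 0 \<le> K \<Longrightarrow> \<kappa> * y powr (m * \<mu>) \<le> l \<or> y \<le> Y0 \<Longrightarrow>
      (\<And>M. l ^ M * I \<le> W * (A * real (2 * n + m * M) powr \<mu>) ^ (2 * n) *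
        (S * (2 * (A * real (2 * n + m * M) powr \<mu>)) ^ m) ^ M * K) \<Longrightarrow>
      I \<le> C * K * exp (- \<epsilon> * y)"
proof -
  \<comment> \<open>\<open>B * b = \<kappa> / exp 1\<close> and
    \<open>r powr (\<mu> * m) = b\<close>: for L at most r y, the cost S (2 A L^\<mu>)^m of one
    application of P is at most \<kappa> y^(m\<mu>) / e. The choice (m + 1) \<delta> = r ensures L
    \<le> r y when M is the floor of \<delta> y and M \<ge> 2n. The added 1 keeps B positive if S =
    0.\<close>
  define B where "B = S * (2 * A) ^ m + 1"
  have B: "B > 0" using S A by (simp add: B_def add_nonneg_pos)
  define b where "b = \<kappa> / (exp 1 * B)"
  have b: "b > 0" using \<kappa> B by (simp add: b_def)
  define r where "r = b powr (1 / (\<mu> * m))"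
  have r: "r > 0" "r powr (\<mu> * m) = b" using b \<mu> m by (simp_all add: r_def powr_powr)
  define \<delta> where "\<delta> = r / (m + 1)"
  have \<delta>: "\<delta> > 0" "(m + 1) * \<delta> = r" using r by (simp_all add: \<delta>_def add_nonneg_pos)
  \<comment> \<open>M applications gain exp (- \<delta> y) up to a constant. The factor L^(2n\<mu>)
    is at most z^N with z = r y, and x \<le> exp x for x = a z / N bounds z^N by (N/a)^N exp (a z).
    Since \<open>a * r = \<delta> / 2\<close>, half of the gain survives.\<close>
  define N where "N = nat \<lceil>2 * n * \<mu>\<rceil>"
  have N: "2 * n * \<mu> \<le> N" "N > 0" using \<mu> n by (auto simp: N_def)
  define a where "a = 1 / (2 * (real m + 1))"
  have a: "a > 0" "a * r = \<delta> / 2" by (simp_all add: a_def \<delta>_def)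
  \<comment> \<open>For y > Y1 the eigenvalue bound holds and \<delta> y > 2n + 1, hence M \<ge> 2n.
    For the other y the hypothesis with M = 0 suffices, and C2 carries the missing exp (\<delta> Y1
    / 2). The factor \<open>exp 1\<close> in C1 makes up for the floor in M.\<close>
  define Y1 where "Y1 = max Y0 ((2 * n + 1) / \<delta>)"
  define C1 where "C1 = W * A ^ (2 * n) * (N / a) ^ N * exp 1"
  define C2 where "C2 = W * (A * real (2 * n) powr \<mu>) ^ (2 * n) * exp (\<delta> / 2 * Y1)"
  have C: "C1 \<ge> 0" "C2 \<ge> 0" using W A a by (simp_all add: C1_def C2_def)
  have main: "I \<le> (C1 + C2 + 1) * K * exp (- (\<delta> / 2) * y)"
    if y: "0 \<le> y" and I: "0 \<le> I" and K: "0 \<le> K" and l: "\<kappa> * y powr (m * \<mu>) \<le> l \<or> y \<le> Y0"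
      and bound: "\<And>M. l ^ M * I \<le> W * (A * real (2 * n + m * M) powr \<mu>) ^ (2 * n) *
        (S * (2 * (A * real (2 * n + m * M) powr \<mu>)) ^ m) ^ M * K"
    for y l I K
  proof (cases "y \<le> Y1")
    case True
    have "I \<le> W * (A * real (2 * n) powr \<mu>) ^ (2 * n) * K" using bound[of 0] by simp
    also have "\<dots> = C2 * K * exp (- (\<delta> / 2) * Y1)"
      by (simp add: C2_def mult_ac exp_add[symmetric] flip: mult.assoc)
    also have "\<dots> \<le> (C1 + C2 + 1) * K * exp (- (\<delta> / 2) * y)"
      using C K True \<delta>(1) by (intro mult_mono) auto
    finally show ?thesis .
  next
    case False
    then have yY: "y > (2 * n + 1) / \<delta>" and l: "\<kappa> * y powr (m * \<mu>) \<le> l"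
      using l by (auto simp: Y1_def)
    define M where "M = nat \<lfloor>\<delta> * y\<rfloor>"
    have "\<delta> * y > 2 * n + 1" using yY \<delta> by (simp add: field_simps)
    then have M: "real M \<le> \<delta> * y" "\<delta> * y \<le> real M + 1" "2 * n \<le> M" "M > 0"
      using n by (auto simp: M_def le_nat_iff le_floor_iff)
    have ypos: "y > 0" using \<open>\<delta> * y > 2 * n + 1\<close> y by (cases "y = 0") auto
    define z where "z = r * y"
    define L where "L = real (2 * n + m * M)"
    have L: "L \<ge> 1" unfolding L_def by (subst of_nat_1[symmetric], subst of_nat_le_iff) (use n in simp)
    have "L \<le> (m + 1) * real M" using M(3) by (simp add: L_def algebra_simps)
    also have "\<dots> \<le> (m + 1) * (\<delta> * y)" using M by (intro mult_left_mono) auto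
    finally have Lz: "L \<le> z" by (simp add: z_def flip: \<delta>(2) mult.assoc)
    have lpos: "l > 0" using l \<kappa> ypos by (intro less_le_trans[OF _ l]) auto
    have "S * (2 * (A * L powr \<mu>)) ^ m = S * (2 * A) ^ m * L powr (\<mu> * m)"
      using L by (simp add: power_mult_distrib mult_ac powr_powr flip: powr_realpow)
    also have "\<dots> \<le> B * z powr (\<mu> * m)"
      using S A L Lz \<mu> by (intro mult_mono powr_mono2) (auto simp: B_def)
    also have "z powr (\<mu> * m) = b * y powr (m * \<mu>)"
      using r y by (simp add: z_def powr_mult mult.commute)
    also have "B * (b * y powr (m * \<mu>)) = exp (-1) * (\<kappa> * y powr (m * \<mu>))"
      using B by (simp add: b_def exp_minus field_simps)
    also have "\<dots> \<le> exp (-1) * l" using l by simp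
    finally have fac: "S * (2 * (A * L powr \<mu>)) ^ m \<le> exp (-1) * l" .
    have "(L powr \<mu>) ^ (2 * n) = L powr (2 * n * \<mu>)"
      using L by (simp add: powr_powr mult.commute flip: powr_realpow)
    also have "\<dots> \<le> L powr N" using L N by (intro powr_mono) auto
    also have "\<dots> = L ^ N" using L by (simp add: powr_realpow)
    also have "\<dots> \<le> z ^ N" using L Lz by (intro power_mono) auto
    also have "\<dots> = (N / a) ^ N * (a * z / N) ^ N"
      using N a by (simp flip: power_mult_distrib)
    also have "\<dots> \<le> (N / a) ^ N * exp (a * z / N) ^ N"
    proof (intro mult_left_mono power_mono)
      show "a * z / N \<le> exp (a * z / N)"
        using exp_ge_add_one_self[of "a * z / N"] by linarith
    qed (use a r y in \<open>auto simp: z_def\<close>)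
    also have "exp (a * z / N) ^ N = exp (\<delta> / 2 * y)"
      using N a by (simp add: z_def flip: exp_of_nat_mult mult.assoc)
    finally have poly: "(L powr \<mu>) ^ (2 * n) \<le> (N / a) ^ N * exp (\<delta> / 2 * y)" .
    have "l ^ M * I \<le> W * (A * L powr \<mu>) ^ (2 * n) * (S * (2 * (A * L powr \<mu>)) ^ m) ^ M * K"
      using bound[of M] by (simp add: L_def)
    also have "\<dots> \<le> W * (A ^ (2 * n) * ((N / a) ^ N * exp (\<delta> / 2 * y))) * (exp (-1) * l) ^ M * K"
    proof (rule mult_right_mono[OF mult_mono[OF _ power_mono[OF fac]] K])
      show "W * (A * L powr \<mu>) ^ (2 * n) \<le> W * (A ^ (2 * n) * ((N / a) ^ N * exp (\<delta> / 2 * y)))"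
        unfolding power_mult_distrib using W A poly by (intro mult_left_mono) auto
    qed (use W A S a in auto)
    also have "\<dots> = l ^ M * (W * (A ^ (2 * n) * ((N / a) ^ N * exp (\<delta> / 2 * y))) * exp (- real M) * K)"
      by (simp add: power_mult_distrib mult_ac flip: exp_of_nat_mult)
    finally have "I \<le> W * (A ^ (2 * n) * ((N / a) ^ N * exp (\<delta> / 2 * y))) * exp (- real M) * K"
      using lpos by simp
    also have "\<dots> \<le> W * (A ^ (2 * n) * ((N / a) ^ N * exp (\<delta> / 2 * y))) * exp (1 - \<delta> * y) * K"
      using W A K a M by (intro mult_right_mono mult_left_mono) auto
    also have "\<dots> = C1 * K * (exp (\<delta> / 2 * y) * exp (- (\<delta> * y)))"
      by (simp add: C1_def exp_diff exp_minus field_simps)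
    also have "exp (\<delta> / 2 * y) * exp (- (\<delta> * y)) = exp (- (\<delta> / 2) * y)"
      by (simp flip: exp_add)
    also have "C1 * K * exp (- (\<delta> / 2) * y) \<le> (C1 + C2 + 1) * K * exp (- (\<delta> / 2) * y)"
      using C K by (intro mult_right_mono) auto
    finally show ?thesis .
  qed
  show ?thesis
    by (rule that[of "\<delta> / 2" "C1 + C2 + 1"]) (use \<delta> C main in auto)
qed

section \<open>From factorial bounds to bounds on one scale\<close>

lemma mi_fact_le_power:
  assumes "mi_size \<alpha> \<le> L" shows "mi_fact \<alpha> \<le> real L ^ mi_size \<alpha>"
proof -
  have "mi_fact \<alpha> \<le> (\<Prod>i\<in>UNIV. real L ^ \<alpha> i)"
    unfolding mi_fact_def
  proof (intro prod_mono conjI)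
    fix i
    have "\<alpha> i \<le> L" using le_mi_size[of \<alpha> i] assms by simp
    then have "fact (\<alpha> i) \<le> L ^ \<alpha> i"
      using fact_le_power[of "\<alpha> i", where 'a = nat] power_mono[of "\<alpha> i" L "\<alpha> i"] by simp
    then have "real (fact (\<alpha> i)) \<le> real (L ^ \<alpha> i)" by (simp only: of_nat_le_iff)
    then show "fact (\<alpha> i) \<le> real L ^ \<alpha> i" by simp
  qed auto
  then show ?thesis by (simp add: mi_size_def power_sum)
qed

lemma mi_fact_pos: "mi_fact \<alpha> > 0"
  unfolding mi_fact_def by (intro prod_pos) auto

text \<open>Up to order L every \<alpha>! is at most L^|\<alpha>|, which turns a Gelfand-Shilov
  bound into a geometric one whose ratio depends on L. A' may exceed A, so that the ratio can be
  kept at least 1.\<close>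

lemma mixed_bound_of_factorial_bound:
  fixes f :: "real^'n::finite \<Rightarrow> complex"
  assumes sm: "smooth f" and \<mu>: "\<mu> \<ge> 0" and A: "0 < A" "A \<le> A'" and K: "K \<ge> 0"
    and f: "\<And>\<alpha> \<beta> x. \<bar>mi_power x \<alpha>\<bar> * cmod (deriv_x \<beta> f x) \<le>
      K * (A ^ (mi_size \<alpha> + mi_size \<beta>) * (mi_fact \<alpha> * mi_fact \<beta>) powr \<mu>)"
  shows "mixed_bound (A' * real L powr \<mu>) L K f"
  unfolding mixed_bound_def
proof (intro conjI allI impI sm)
  fix \<alpha> \<beta> :: "'n mindex" and x :: "real^'n"
  assume s: "mi_size \<alpha> + mi_size \<beta> \<le> L"
  let ?k = "mi_size \<alpha> + mi_size \<beta>"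
  have "mi_fact \<alpha> * mi_fact \<beta> \<le> real L ^ mi_size \<alpha> * real L ^ mi_size \<beta>"
    using s by (intro mult_mono mi_fact_le_power) (auto simp: mi_fact_pos less_imp_le)
  then have "(mi_fact \<alpha> * mi_fact \<beta>) powr \<mu> \<le> (real L ^ ?k) powr \<mu>"
    using \<mu> by (intro powr_mono2) (auto simp: power_add mi_fact_pos less_imp_le)
  \<comment> \<open>For L = 0 the order \<open>?k\<close> is 0 too, and both sides are 1.\<close>
  also have "\<dots> = (real L powr \<mu>) ^ ?k"
    by (cases "L = 0"; cases "?k = 0")
      (use s in \<open>auto simp: powr_powr mult.commute simp flip: powr_realpow\<close>)
  finally have "A ^ ?k * (mi_fact \<alpha> * mi_fact \<beta>) powr \<mu> \<le> A' ^ ?k * (real L powr \<mu>) ^ ?k"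
    using A by (intro mult_mono power_mono) auto
  then have "K * (A ^ ?k * (mi_fact \<alpha> * mi_fact \<beta>) powr \<mu>) \<le> K * (A' * real L powr \<mu>) ^ ?k"
    using K by (simp add: power_mult_distrib mult_left_mono)
  then show "\<bar>mi_power x \<alpha>\<bar> * cmod (deriv_x \<beta> f x) \<le> K * (A' * real L powr \<mu>) ^ ?k"
    using f[of x \<alpha> \<beta>] by linarith
qed

text \<open>Here \<mu> \<ge> 1/2 enters, as L \<le> L^(2\<mu>). The scale A L^\<mu> is thus
  admissible for the L = 2n + mM orders that are spent on P^M and on integrability.\<close>

lemma radius_properties:
  assumes "\<mu> \<ge> 1/2" "A \<ge> 1" "L \<ge> 1"
  shows "A * real L powr \<mu> \<ge> 1" "real L \<le> (A * real L powr \<mu>)\<^sup>2"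
proof -
  have 1: "real L powr \<mu> \<ge> 1" using assms by (intro ge_one_powr_ge_zero) auto
  show "A * real L powr \<mu> \<ge> 1" using mult_mono[OF assms(2) 1] assms by simp
  have "real L = real L powr (2 * (1/2))" using assms by simp
  also have "\<dots> \<le> real L powr (2 * \<mu>)" using assms by (intro powr_mono) auto
  also have "\<dots> = (real L powr \<mu>)\<^sup>2" using assms by (simp add: powr_powr mult.commute flip: powr_realpow)
  also have "\<dots> \<le> (A * real L powr \<mu>)\<^sup>2"
    using assms by (intro power_mono) (auto intro: mult_right_mono[of 1 A, simplified])
  finally show "real L \<le> (A * real L powr \<mu>)\<^sup>2" .
qed

lemma schwartz_of_factorial_bound:
  fixes f :: "real^'n::finite \<Rightarrow> complex"
  assumes "\<And>L. L \<ge> 1 \<Longrightarrow> mixed_bound (A * real L powr \<mu>) L K f" "\<mu> \<ge> 1/2" "A \<ge> 1"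
  shows "schwartz f"
proof (rule schwartzI)
  fix N
  \<comment> \<open>\<open>Suc N\<close> in place of N, because for N = 0 the scale would contain
    \<open>0 powr \<mu> = 0\<close> and fall below 1.\<close>
  have "mixed_bound (A * real (Suc N) powr \<mu>) N K f"
    by (rule mixed_bound_weaken[OF assms(1)[of "Suc N"]]) (use assms(3) in auto)
  then show "\<exists>R\<ge>1. \<exists>K. mixed_bound R N K f"
    using radius_properties(1)[OF assms(2,3), of "Suc N"] by auto
qed

lemma gelfand_shilov_schwartz:
  fixes f :: "real^'n::finite \<Rightarrow> complex"
  assumes "f \<in> gelfand_shilov \<mu>" "\<mu> \<ge> 1/2" shows "schwartz f"
proof -
  obtain A where A: "A > 0" and fin: "(SUP \<alpha>. SUP \<beta>. SUP x.
        ennreal (cmod (of_real (mi_power x \<alpha>) * deriv_x \<beta> f x) /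
          (A ^ (mi_size \<alpha> + mi_size \<beta>) * (mi_fact \<alpha> * mi_fact \<beta>) powr \<mu>))) < \<infinity>" (is "?S < \<infinity>")
    and sm: "smooth f"
    using assms(1) unfolding gelfand_shilov_def by blast
  define K where "K = enn2real ?S"
  have bound: "\<bar>mi_power x \<alpha>\<bar> * cmod (deriv_x \<beta> f x) \<le>
      K * (A ^ (mi_size \<alpha> + mi_size \<beta>) * (mi_fact \<alpha> * mi_fact \<beta>) powr \<mu>)" for \<alpha> \<beta> x
  proof -
    have "ennreal (cmod (of_real (mi_power x \<alpha>) * deriv_x \<beta> f x) /
          (A ^ (mi_size \<alpha> + mi_size \<beta>) * (mi_fact \<alpha> * mi_fact \<beta>) powr \<mu>)) \<le> ?S"
      by (rule SUP_upper2[of \<alpha>, OF UNIV_I], rule SUP_upper2[of \<beta>, OF UNIV_I], rule SUP_upper2[of x, OF UNIV_I]) simp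
    also have "?S = ennreal K" using fin by (simp add: K_def less_top)
    finally have "cmod (of_real (mi_power x \<alpha>) * deriv_x \<beta> f x) /
          (A ^ (mi_size \<alpha> + mi_size \<beta>) * (mi_fact \<alpha> * mi_fact \<beta>) powr \<mu>) \<le> K"
      by (subst (asm) ennreal_le_iff) (simp_all add: K_def)
    then show ?thesis
      using A mi_fact_pos[of \<alpha>] mi_fact_pos[of \<beta>] by (simp add: norm_mult pos_divide_le_eq)
  qed
  show ?thesis
    by (rule schwartz_of_factorial_bound[of "max 1 A" \<mu> K])
      (use assms A sm bound in \<open>auto intro!: mixed_bound_of_factorial_bound[of _ _ A] simp: K_def\<close>)
qed

text \<open>Only the L^2 norm of g enters, so the bound is uniform over the eigenfunctions. In place
  of Cauchy-Schwarz: w |g| \<le> (w^2 + |g|^2) / 2, and w^2 \<le> w because 0 < w \<le> 1.\<close>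

lemma cmod_integral_weight_le:
  fixes f g :: "real^'n::finite \<Rightarrow> complex"
  assumes f: "f \<in> borel_measurable borel" "\<And>x. cmod (f x) \<le> D * weight x"
    and g: "square_integrable g" "L2_inner g g = 1"
  shows "cmod (\<integral>x. f x * g x \<partial>lborel) \<le> D * ((\<integral>x. weight (x :: real^'n) \<partial>lborel) + 1) / 2"
proof -
  have D: "D \<ge> 0" using order_trans[OF norm_ge_zero f(2)[of 0]] weight_pos[of "0::real^'n"]
    by (metis less_le_not_le mult_less_0_iff not_le)
  have gm: "g \<in> borel_measurable borel" and g2: "integrable lborel (\<lambda>x. (cmod (g x))\<^sup>2)"
    using g(1) by (auto simp: square_integrable_def)
  have "complex_of_real (\<integral>x. (cmod (g x))\<^sup>2 \<partial>lborel) = 1"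
    using g(2) by (simp add: L2_inner_def flip: complex_norm_square integral_complex_of_real)
  then have one: "(\<integral>x. (cmod (g x))\<^sup>2 \<partial>lborel) = 1" by (simp only: of_real_eq_1_iff)
  define v where "v x = D / 2 * (weight x + (cmod (g x))\<^sup>2)" for x
  have bd: "norm (f x * g x) \<le> v x" for x
  proof -
    have "2 * (weight x * cmod (g x)) \<le> (weight x)\<^sup>2 + (cmod (g x))\<^sup>2"
      using zero_le_power2[of "weight x - cmod (g x)"] by (simp add: power2_eq_square algebra_simps)
    moreover have "(weight x)\<^sup>2 \<le> weight x"
      using weight_le_1[of x] weight_pos[of x] by (simp add: power2_eq_square mult_left_le)
    ultimately have "weight x * cmod (g x) \<le> (weight x + (cmod (g x))\<^sup>2) / 2" by simp
    then have "D * (weight x * cmod (g x)) \<le> v x"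
      using D mult_left_mono by (fastforce simp: v_def)
    moreover have "cmod (f x) * cmod (g x) \<le> D * weight x * cmod (g x)"
      by (intro mult_right_mono f) auto
    ultimately show ?thesis by (simp add: norm_mult mult.assoc)
  qed
  have v: "integrable lborel v"
    unfolding v_def using g2 integrable_weight by (intro integrable_mult_right Bochner_Integration.integrable_add)
  have "integrable lborel (\<lambda>x. f x * g x)"
    by (rule Bochner_Integration.integrable_bound[OF v])
      (use bd f gm in \<open>auto intro!: AE_I2 order_trans[OF _ abs_ge_self] borel_measurable_times\<close>)
  then have "norm (\<integral>x. f x * g x \<partial>lborel) \<le> (\<integral>x. v x \<partial>lborel)"
    using v bd by (intro Bochner_Integration.integral_norm_bound_integral) auto
  also have "\<dots> = D * ((\<integral>x. weight (x :: real^'n) \<partial>lborel) + 1) / 2"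
    unfolding v_def
    using Bochner_Integration.integral_add[OF integrable_weight g2] one by simp
  finally show ?thesis .
qed

text \<open>Of the orders of f, mM are spent on the transposed P^M; the 2n left over bound the
  result by a multiple of \<open>weight\<close>, which is then integrated against g. The right-hand
  side does not depend on g.\<close>

lemma eigenfunction_coefficient_bound:
  fixes f g :: "real^'n::finite \<Rightarrow> complex"
  assumes f: "mixed_bound R (2 * CARD('n) + m * M) K f" "schwartz f" and R: "R \<ge> 1" "real (2 * CARD('n) + m * M) \<le> R\<^sup>2"
    and g: "schwartz g" "square_integrable g" "L2_inner g g = 1"
    and ev: "\<And>x. diff_op m c g x = of_real l * g x"
  shows "\<bar>l\<bar> ^ M * cmod (\<integral>x. f x * g x \<partial>lborel) \<le>
    (2 ^ CARD('n) * ((\<integral>x. weight (x :: real^'n) \<partial>lborel) + 1) / 2) * R ^ (2 * CARD('n)) * (coeff_sum m c * (2 * R) ^ m) ^ M * K"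
proof -
  have mb: "mixed_bound R (2 * CARD('n)) ((coeff_sum m c * (2 * R) ^ m) ^ M * K) ((transposed_op m c ^^ M) f)"
    using f(1) R by (intro mixed_bound_transposed_op_funpow)
  have "\<bar>l\<bar> ^ M * cmod (\<integral>x. f x * g x \<partial>lborel) = cmod (of_real l ^ M * (\<integral>x. f x * g x \<partial>lborel))"
    by (simp add: norm_mult norm_power)
  also have "\<dots> = cmod (\<integral>x. (transposed_op m c ^^ M) f x * g x \<partial>lborel)"
    by (simp add: integral_eigenfunction[OF f(2) g(1) ev])
  also have "\<dots> \<le> (2 ^ CARD('n) * R ^ (2 * CARD('n)) * ((coeff_sum m c * (2 * R) ^ m) ^ M * K)) *
      ((\<integral>x. weight (x :: real^'n) \<partial>lborel) + 1) / 2"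
    by (rule cmod_integral_weight_le)
      (use mixed_bound_weight[OF mb R(1)] g schwartz_transposed_op_funpow[OF f(2)] in
        \<open>auto intro: schwartz_measurable\<close>)
  finally show ?thesis by (simp add: mult_ac)
qed

section \<open>Slices and coefficient functions\<close>

lemma partial_deriv_slice:
  "partial_deriv (0, e) g (t, x) = partial_deriv e (\<lambda>x. g (t, x)) x"
  by (simp add: partial_deriv_def)

lemma smooth_slice:
  fixes g :: "real \<times> 'a::euclidean_space \<Rightarrow> 'b::real_normed_vector"
  assumes "smooth g" shows "smooth (\<lambda>x. g (t, x))"
proof (rule smooth_coinduct[of _ "{(\<lambda>x. g (t, x)) | g. smooth g}"])
  fix h :: "'a \<Rightarrow> 'b" assume "h \<in> {(\<lambda>x. g (t, x)) | g. smooth g}"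
  then obtain g where g: "h = (\<lambda>x. g (t, x))" "smooth g" by auto
  show "h differentiable_on UNIV"
    unfolding g(1) differentiable_on_def
  proof
    fix x :: 'a
    have "(Pair t has_derivative Pair 0) (at x)"
      by (auto intro!: derivative_eq_intros)
    then have "Pair t differentiable at x" by (rule differentiableI)
    then show "(\<lambda>x. g (t, x)) differentiable at x"
      using smooth_differentiable[OF g(2)]
      by (intro differentiable_compose[of g "Pair t"]) (auto simp: differentiable_on_def)
  qed
  fix b :: 'a assume b: "b \<in> Basis"
  then have "smooth (partial_deriv (0, b) g)"
    using g(2) by (intro smooth_partial_deriv) (auto simp: Basis_prod_def)
  then show "partial_deriv b h \<in> {(\<lambda>x. g (t, x)) | g. smooth g}"
    unfolding mem_Collect_eq
    by (intro exI[of _ "partial_deriv (0, b) g"]) (simp add: g(1) fun_eq_iff partial_deriv_slice)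
qed (use assms in auto)

lemma funpow_partial_deriv_slice:
  "(\<lambda>x. (partial_deriv (0, b) ^^ k) f (t, x)) = (partial_deriv b ^^ k) (\<lambda>x. f (t, x))"
  by (induction k) (auto simp: partial_deriv_slice)

lemma mi_deriv_slice:
  "mi_deriv (\<lambda>i. (0, e i)) \<beta> g (t, x) = mi_deriv e \<beta> (\<lambda>x. g (t, x)) x"
proof -
  have "(\<lambda>x. foldr (\<lambda>i. partial_deriv (0, e i) ^^ \<beta> i) is g (t, x)) =
      foldr (\<lambda>i. partial_deriv (e i) ^^ \<beta> i) is (\<lambda>x. g (t, x))" for "is"
    by (induction "is") (auto simp: funpow_partial_deriv_slice)
  then show ?thesis by (simp add: mi_deriv_def fun_eq_iff)
qed

abbreviation time_deriv :: "nat \<Rightarrow> (real \<times> 'a::real_normed_vector \<Rightarrow> complex) \<Rightarrow> real \<times> 'a \<Rightarrow> complex" where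
  "time_deriv k \<equiv> partial_deriv (1, 0) ^^ k"

lemma smooth_time_deriv: "smooth \<theta> \<Longrightarrow> smooth (time_deriv k \<theta>)"
  by (rule smooth_funpow_partial_deriv) (auto simp: Basis_prod_def)

lemma time_deriv_has_vector_derivative:
  assumes "smooth \<theta>"
  shows "((\<lambda>t. time_deriv k \<theta> (t, x)) has_vector_derivative time_deriv (Suc k) \<theta> (t, x)) (at t)"
  using has_vector_derivative_partial_deriv[OF smooth_differentiable[OF smooth_time_deriv[OF assms, of k]],
      of "(0, x)" "(1, 0)" t UNIV] by simp

lemma time_deriv_periodic:
  assumes "\<And>t x. \<theta> (t + p, x) = \<theta> (t, x)"
  shows "time_deriv k \<theta> (t + p, x) = time_deriv k \<theta> (t, x)"
proof (induction k arbitrary: t x)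
  case (Suc k)
  have "time_deriv k \<theta> (t + p + s, x) = time_deriv k \<theta> (t + s, x)" for s
    using Suc[of "t + s" x] by (simp add: algebra_simps)
  then show ?case by (simp add: partial_deriv_def[of _ "time_deriv k \<theta>"])
qed (simp add: assms)

text \<open>The t-derivatives are booked in the constant, as A^k k!^\<sigma>, with the same scale in
  x for every k and t. An estimate for functions of x that is linear in K thus covers all
  t-derivatives at once.\<close>

lemma S_C_space_mixed_bound:
  fixes \<theta> :: "real \<times> (real^'n::finite) \<Rightarrow> complex"
  assumes \<theta>: "\<theta> \<in> S_C_space \<sigma> \<mu> A" and A: "A > 0" and \<mu>: "\<mu> \<ge> 0"
  shows "mixed_bound (max 1 A * real L powr \<mu>) L
    (enn2real (S_norm \<sigma> \<mu> A \<theta>) * (A ^ k * fact k powr \<sigma>)) (\<lambda>x. time_deriv k \<theta> (t, x))"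
proof (rule mixed_bound_of_factorial_bound[where A = A])
  let ?N = "enn2real (S_norm \<sigma> \<mu> A \<theta>)"
  have sm: "smooth \<theta>" and fin: "S_norm \<sigma> \<mu> A \<theta> < \<infinity>" using \<theta> by (auto simp: S_C_space_def)
  show "smooth (\<lambda>x. time_deriv k \<theta> (t, x))" by (intro smooth_slice smooth_time_deriv sm)
  fix \<alpha> \<beta> :: "'n mindex" and x :: "real^'n"
  let ?d = "A ^ (mi_size \<alpha> + mi_size \<beta> + k) * fact k powr \<sigma> * (mi_fact \<alpha> * mi_fact \<beta>) powr \<mu>"
  have "ennreal (cmod (of_real (mi_power x \<alpha>) * deriv_tx k \<beta> \<theta> (t, x)) / ?d) \<le> S_norm \<sigma> \<mu> A \<theta>"
    unfolding S_norm_def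
    by (rule SUP_upper2[of \<alpha>, OF UNIV_I], rule SUP_upper2[of \<beta>, OF UNIV_I],
        rule SUP_upper2[of k, OF UNIV_I], rule SUP_upper2[of "(t, x)", OF UNIV_I]) simp
  also have "\<dots> = ennreal ?N" using fin by (simp add: less_top)
  finally have "cmod (of_real (mi_power x \<alpha>) * deriv_tx k \<beta> \<theta> (t, x)) / ?d \<le> ?N"
    by (subst (asm) ennreal_le_iff) simp_all
  moreover have "?d > 0" using A mi_fact_pos[of \<alpha>] mi_fact_pos[of \<beta>] by simp
  ultimately have "\<bar>mi_power x \<alpha>\<bar> * cmod (deriv_tx k \<beta> \<theta> (t, x)) \<le> ?N * ?d"
    by (simp add: pos_divide_le_eq norm_mult)
  then show "\<bar>mi_power x \<alpha>\<bar> * cmod (deriv_x \<beta> (\<lambda>x. time_deriv k \<theta> (t, x)) x) \<le>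
      ?N * (A ^ k * fact k powr \<sigma>) * (A ^ (mi_size \<alpha> + mi_size \<beta>) * (mi_fact \<alpha> * mi_fact \<beta>) powr \<mu>)"
    by (simp add: mi_deriv_slice power_add mult_ac)
qed (use A \<mu> in auto)

section \<open>Coefficient functions and their Gevrey norms\<close>

definition coefficient :: "(real^'n::finite \<Rightarrow> complex) \<Rightarrow> (real \<times> (real^'n) \<Rightarrow> complex) \<Rightarrow> nat \<Rightarrow> real \<Rightarrow> complex" where
  "coefficient g \<theta> k t = (\<integral>x. time_deriv k \<theta> (t, x) * g x \<partial>lborel)"

lemma tensor_form_coefficient: "tensor_form a g \<theta> = a (coefficient g \<theta> 0)"
  by (simp add: tensor_form_def coefficient_def[abs_def])

lemma S_C_space_schwartz:
  assumes "\<theta> \<in> S_C_space \<sigma> \<mu> A" "A > 0" "\<mu> \<ge> 1/2"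
  shows "schwartz (\<lambda>x. time_deriv k \<theta> (t, x))"
  by (rule schwartz_of_factorial_bound[OF S_C_space_mixed_bound]) (use assms in auto)

text \<open>The t-derivatives of \<theta> lie below a multiple of \<open>weight\<close> uniformly in
  t, which justifies differentiation under the integral. Hence the functions
  \<open>coefficient g \<theta> k\<close> are the successive derivatives of
  \<open>coefficient g \<theta> 0\<close>.\<close>

lemma coefficient_has_vector_derivative:
  fixes \<theta> :: "real \<times> (real^'n::finite) \<Rightarrow> complex"
  assumes \<theta>: "\<theta> \<in> S_C_space \<sigma> \<mu> A" "A > 0" "\<mu> \<ge> 1/2" and g: "schwartz g"
  shows "(coefficient g \<theta> k has_vector_derivative coefficient g \<theta> (Suc k) t) (at t)"
  unfolding coefficient_def[abs_def]
proof -
  let ?n = "CARD('n)"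
  define R where "R = max 1 A * real (2 * ?n) powr \<mu>"
  have R: "R \<ge> 1" unfolding R_def using \<theta> by (intro radius_properties) auto
  define K where "K = enn2real (S_norm \<sigma> \<mu> A \<theta>) * (A ^ Suc k * fact (Suc k) powr \<sigma>)"
  define D where "D = 2 ^ ?n * R ^ (2 * ?n) * K"
  have K: "K \<ge> 0" using \<theta> by (simp add: K_def)
  have D: "D \<ge> 0" using R K by (simp add: D_def)
  have bd: "cmod (time_deriv (Suc k) \<theta> (s, x)) \<le> D * weight x" for s x
    using mixed_bound_weight[OF S_C_space_mixed_bound[OF \<theta>(1,2), of "2 * ?n" "Suc k" s], of x] R \<theta>(3)
    by (simp add: D_def K_def R_def)
  obtain B where B: "B \<ge> 0" "\<And>x. cmod (g x) \<le> B * weight x" using schwartz_weight[OF g] by blast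
  note sch = S_C_space_schwartz[OF \<theta>]
  show "((\<lambda>t. \<integral>x. time_deriv k \<theta> (t, x) * g x \<partial>lborel) has_vector_derivative
      (\<integral>x. time_deriv (Suc k) \<theta> (t, x) * g x \<partial>lborel)) (at t)"
  proof (rule has_vector_derivative_integral[where v = "\<lambda>x. D * B * weight x"])
    fix s :: real and x :: "real^'n"
    show "((\<lambda>s. time_deriv k \<theta> (s, x) * g x) has_vector_derivative time_deriv (Suc k) \<theta> (s, x) * g x) (at s)"
      using \<theta> by (intro has_vector_derivative_mult_left time_deriv_has_vector_derivative)
        (simp add: S_C_space_def)
    show "integrable lborel (\<lambda>x. time_deriv k \<theta> (s, x) * g x)"
      by (rule integrable_schwartz_mult[OF sch g])
    have "cmod (g x) \<le> B" using B(2)[of x] B(1) weight_le_1[of x] mult_left_le[of "weight x" B] by linarith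
    then have "cmod (time_deriv (Suc k) \<theta> (s, x) * g x) \<le> (D * weight x) * B"
      unfolding norm_mult using bd[of s x] D weight_pos[of x] by (intro mult_mono) auto
    then show "cmod (time_deriv (Suc k) \<theta> (s, x) * g x) \<le> D * B * weight x" by (simp add: mult_ac)
  qed (use sch[of "Suc k" t] g integrable_weight in
      \<open>auto intro!: borel_measurable_times schwartz_measurable simp del: funpow.simps\<close>)
qed

text \<open>The functions \<open>coefficient g \<theta> k\<close> form a set closed under
  differentiation, so smoothness follows by coinduction and the Gevrey norm is read off from the
  bounds.\<close>

lemma coefficient_gevrey:
  fixes \<theta> :: "real \<times> (real^'n::finite) \<Rightarrow> complex"
  assumes \<theta>: "\<theta> \<in> S_C_space \<sigma> \<mu> A" "A > 0" "\<mu> \<ge> 1/2" and g: "schwartz g"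
    and bd: "\<And>k t. cmod (coefficient g \<theta> k t) \<le> D * (A ^ k * fact k powr \<sigma>)"
  shows "coefficient g \<theta> 0 \<in> gevrey_h \<sigma> A" "gevrey_norm \<sigma> A (coefficient g \<theta> 0) \<le> ennreal D"
proof -
  let ?c = "coefficient g \<theta>"
  note der = coefficient_has_vector_derivative[OF \<theta> g]
  have pd: "partial_deriv 1 (?c k) = ?c (Suc k)" for k
  proof
    fix t show "partial_deriv 1 (?c k) t = ?c (Suc k) t"
      using partial_deriv_eq[OF der[of k t, unfolded has_vector_derivative_def], of 1] by simp
  qed
  then have iter: "(partial_deriv 1 ^^ k) (?c 0) = ?c k" for k
    by (induction k) auto
  show norm: "gevrey_norm \<sigma> A (?c 0) \<le> ennreal D"
    unfolding gevrey_norm_def iter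
  proof (intro SUP_least ennreal_leI)
    fix k t
    show "cmod (?c k t) / (A ^ k * fact k powr \<sigma>) \<le> D"
      using bd[of k t] \<theta>(2) by (simp add: pos_divide_le_eq)
  qed
  have "smooth (?c 0)"
  proof (rule smooth_coinduct[of _ "range ?c"])
    show "f differentiable_on UNIV" if "f \<in> range ?c" for f
      using that der by (auto simp: differentiable_on_def has_vector_derivative_def differentiable_def)
  qed (auto simp: pd)
  moreover have "?c 0 (t + 2 * pi) = ?c 0 t" for t
    using \<theta>(1) time_deriv_periodic[of \<theta> "2 * pi" 0] by (simp add: coefficient_def S_C_space_def)
  moreover have "gevrey_norm \<sigma> A (?c 0) < \<infinity>"
    using norm by (simp add: le_less_trans)
  ultimately show "?c 0 \<in> gevrey_h \<sigma> A" by (simp add: gevrey_h_def)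
qed

text \<open>\<epsilon> and C depend on neither \<theta> nor j, and \<theta> enters the bound
  linearly through its norm. This uniformity makes the sum over j a form that is continuous at each
  level A.\<close>

lemma coefficient_decay:
  fixes \<phi> :: "nat \<Rightarrow> real ^ 'n::finite \<Rightarrow> complex"
  assumes \<mu>: "\<mu> \<ge> 1/2" and m: "m > 0" and A: "A > 0"
    and \<phi>: "orthonormal_basis_L2 \<phi>" "\<And>j. j \<ge> 1 \<Longrightarrow> \<phi> j \<in> gelfand_shilov (1/2)"
    and ev: "\<And>j x. j \<ge> 1 \<Longrightarrow> diff_op m c (\<phi> j) x = of_real (ev j) * \<phi> j x"
    and asymp: "\<exists>K>0. (\<lambda>j. \<bar>ev j\<bar>) \<sim>[sequentially] (\<lambda>j. K * real j powr (real m / (2 * real CARD('n))))"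
  obtains \<epsilon> C where "\<epsilon> > 0" "C > 0"
    "\<And>\<theta> j. \<theta> \<in> S_C_space \<sigma> \<mu> A \<Longrightarrow> j \<ge> 1 \<Longrightarrow> coefficient (\<phi> j) \<theta> 0 \<in> gevrey_h \<sigma> A \<and>
      gevrey_norm \<sigma> A (coefficient (\<phi> j) \<theta> 0) \<le>
        ennreal (C * exp (- \<epsilon> * real j powr (1 / (2 * real CARD('n) * \<mu>))) * enn2real (S_norm \<sigma> \<mu> A \<theta>))"
proof -
  let ?n = "CARD('n)"
  let ?y = "\<lambda>j. real j powr (1 / (2 * real ?n * \<mu>))"
  obtain K0 where K0: "K0 > 0" "(\<lambda>j. \<bar>ev j\<bar>) \<sim>[sequentially] (\<lambda>j. K0 * real j powr (real m / (2 * real ?n)))"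
    using asymp by blast
  have "(\<lambda>j. \<bar>ev j\<bar>) \<in> \<Omega>(\<lambda>j. K0 * real j powr (real m / (2 * real ?n)))"
    using asymp_equiv_imp_bigtheta[OF K0(2)] by (rule bigthetaD2)
  then obtain k0 where k0: "k0 > 0"
      "eventually (\<lambda>j. k0 * norm (K0 * real j powr (real m / (2 * real ?n))) \<le> norm \<bar>ev j\<bar>) sequentially"
    by (rule landau_omega.bigE)
  then obtain J where J: "\<And>j. j \<ge> J \<Longrightarrow> k0 * (K0 * real j powr (real m / (2 * real ?n))) \<le> \<bar>ev j\<bar>"
    using K0(1) by (auto simp: eventually_sequentially abs_mult)
  define \<kappa> where "\<kappa> = k0 * K0"
  have \<kappa>: "\<kappa> > 0" using k0 K0 by (simp add: \<kappa>_def)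
  have yp: "?y j powr (m * \<mu>) = real j powr (real m / (2 * real ?n))" for j
    using \<mu> by (simp add: powr_powr field_simps)
  \<comment> \<open>The asymptotics enter as a lower bound from some J on. The finitely many j < J,
    where it may fail, fall under the alternative \<open>y \<le> Y0\<close> of the decay
    lemma.\<close>
  have large: "\<kappa> * ?y j powr (m * \<mu>) \<le> \<bar>ev j\<bar> \<or> ?y j \<le> ?y J" for j
  proof (cases "j \<ge> J")
    case True
    then show ?thesis using J[OF True] unfolding yp by (simp add: \<kappa>_def mult.assoc)
  next
    case False
    then show ?thesis using \<mu> by (intro disjI2 powr_mono2) auto
  qed
  define W where "W = 2 ^ ?n * ((\<integral>x. weight (x :: real^'n) \<partial>lborel) + 1) / 2"
  have W: "W \<ge> 0" unfolding W_def by (auto intro!: add_nonneg_nonneg integral_nonneg simp: weight_pos less_imp_le)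
  have S: "coeff_sum m c \<ge> 0" unfolding coeff_sum_def by (rule sum_nonneg) auto
  obtain \<epsilon> C where \<epsilon>: "\<epsilon> > 0" "C > 0" and decay:
    "\<And>y l I K. 0 \<le> y \<Longrightarrow> 0 \<le> I \<Longrightarrow> 0 \<le> K \<Longrightarrow> \<kappa> * y powr (m * \<mu>) \<le> l \<or> y \<le> ?y J \<Longrightarrow>
      (\<And>M. l ^ M * I \<le> W * (max 1 A * real (2 * ?n + m * M) powr \<mu>) ^ (2 * ?n) *
        (coeff_sum m c * (2 * (max 1 A * real (2 * ?n + m * M) powr \<mu>)) ^ m) ^ M * K) \<Longrightarrow>
      I \<le> C * K * exp (- \<epsilon> * y)"
    using exponential_decay_of_power_bounds[of \<mu> m ?n "max 1 A" "coeff_sum m c" \<kappa> W "?y J"] \<mu> m \<kappa> W S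
    by auto
  show ?thesis
  proof (rule that[OF \<epsilon>])
    fix \<theta> :: "real \<times> (real^'n) \<Rightarrow> complex" and j assume \<theta>: "\<theta> \<in> S_C_space \<sigma> \<mu> A" and j: "1 \<le> (j::nat)"
    have g: "schwartz (\<phi> j)" using \<phi>(2)[OF j] by (rule gelfand_shilov_schwartz) simp
    have sq: "square_integrable (\<phi> j)" "L2_inner (\<phi> j) (\<phi> j) = 1"
      using \<phi>(1) j by (auto simp: orthonormal_basis_L2_def)
    let ?N = "enn2real (S_norm \<sigma> \<mu> A \<theta>)"
    have bd: "cmod (coefficient (\<phi> j) \<theta> k t) \<le> C * exp (- \<epsilon> * ?y j) * ?N * (A ^ k * fact k powr \<sigma>)" for k t
    proof -
      \<comment> \<open>The factor of the k-th t-derivative is absorbed in the K of the decay lemma,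
        so the same \<epsilon> and C serve for all k.\<close>
      have "cmod (coefficient (\<phi> j) \<theta> k t) \<le> C * (?N * (A ^ k * fact k powr \<sigma>)) * exp (- \<epsilon> * ?y j)"
      proof (rule decay[of _ _ _ "\<bar>ev j\<bar>"])
        fix M
        let ?L = "2 * ?n + m * M"
        have "?L \<ge> 1" using zero_less_card_finite[where 'a = 'n] by linarith
        then have R: "max 1 A * real ?L powr \<mu> \<ge> 1" "real ?L \<le> (max 1 A * real ?L powr \<mu>)\<^sup>2"
          using radius_properties[OF \<mu>, of "max 1 A" ?L] by simp_all
        show "\<bar>ev j\<bar> ^ M * cmod (coefficient (\<phi> j) \<theta> k t) \<le> W * (max 1 A * real ?L powr \<mu>) ^ (2 * ?n) *
          (coeff_sum m c * (2 * (max 1 A * real ?L powr \<mu>)) ^ m) ^ M * (?N * (A ^ k * fact k powr \<sigma>))"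
          unfolding coefficient_def W_def using \<mu>
          by (intro eigenfunction_coefficient_bound S_C_space_mixed_bound[OF \<theta> A] R g sq ev j
              S_C_space_schwartz[OF \<theta> A]) auto
      qed (use large A in auto)
      then show ?thesis by (simp add: mult_ac)
    qed
    show "coefficient (\<phi> j) \<theta> 0 \<in> gevrey_h \<sigma> A \<and> gevrey_norm \<sigma> A (coefficient (\<phi> j) \<theta> 0) \<le>
        ennreal (C * exp (- \<epsilon> * ?y j) * ?N)"
      using coefficient_gevrey[OF \<theta> A \<mu> g bd] by simp
  qed
qed

section \<open>Convergence of the series and membership in the dual\<close>

lemma summable_exp_neg_powr:
  assumes "\<epsilon> > 0" "p > 0"
  shows "summable (\<lambda>j. exp (- \<epsilon> * real j powr p))"
proof (rule summable_comparison_test_bigo)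
  show "summable (\<lambda>j. norm (real j powr -2))" by (simp add: summable_real_powr_iff)
  show "(\<lambda>j. exp (- \<epsilon> * real j powr p)) \<in> O(\<lambda>j. real j powr -2)"
    using assms by real_asymp
qed

theorem theorem2p9:
  fixes c :: "'n::finite mindex \<Rightarrow> 'n mindex \<Rightarrow> complex"
    and m :: nat
    and \<phi> :: "nat \<Rightarrow> real ^ 'n \<Rightarrow> complex"
    and ev :: "nat \<Rightarrow> real"
    and a :: "nat \<Rightarrow> (real \<Rightarrow> complex) \<Rightarrow> complex"
    and \<mu> \<sigma> :: real
  assumes "\<mu> \<ge> 1/2" and "\<sigma> \<ge> 1"
    and "m \<ge> 2" and "normal_op m c" and "globally_elliptic m c"
    and "orthonormal_basis_L2 \<phi>"
    and "\<And>j. j \<ge> 1 \<Longrightarrow> \<phi> j \<in> gelfand_shilov (1/2)"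
    and "\<And>j x. j \<ge> 1 \<Longrightarrow> diff_op m c (\<phi> j) x = of_real (ev j) * \<phi> j x"
    and "filterlim (\<lambda>j. \<bar>ev j\<bar>) at_top sequentially"
    and "\<exists>K>0. (\<lambda>j. \<bar>ev j\<bar>) \<sim>[sequentially] (\<lambda>j. K * real j powr (real m / (2 * real CARD('n))))"
    and "\<And>j. j \<ge> 1 \<Longrightarrow> a j \<in> gevrey_dual \<sigma>"
    and "\<And>\<epsilon> h. \<epsilon> > 0 \<Longrightarrow> h > 0 \<Longrightarrow> \<exists>C>0. \<forall>j\<ge>1. \<forall>\<psi>\<in>gevrey_h \<sigma> h.
           ennreal (cmod (a j \<psi>)) \<le>
             ennreal C * gevrey_norm \<sigma> h \<psi> *
             ennreal (exp (\<epsilon> * real j powr (1 / (2 * real CARD('n) * \<mu>))))"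
  shows "\<exists>u \<in> S_dual \<sigma> \<mu>.
    (\<forall>\<theta>\<in>S_space \<sigma> \<mu>. (\<lambda>N. \<Sum>j=1..N. tensor_form (a j) (\<phi> j) \<theta>) \<longlonglongrightarrow> u \<theta>) \<and>
    (\<forall>\<psi>\<in>gevrey \<sigma>. \<forall>j\<ge>1. a j \<psi> = u (\<lambda>(t, x). \<psi> t * cnj (\<phi> j x))) \<and>
    ((\<forall>j\<ge>1. \<forall>x. \<phi> j x \<in> \<real>) \<longrightarrow>
      (\<forall>\<psi>\<in>gevrey \<sigma>. \<forall>j\<ge>1. a j \<psi> = u (\<lambda>(t, x). \<psi> t * \<phi> j x)))"
proof -
  let ?y = "\<lambda>j. real j powr (1 / (2 * real CARD('n) * \<mu>))"
  have \<mu>: "\<mu> \<ge> 1/2" "\<mu> > 0" "m > 0" using assms(1,3) by auto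
  define T where "T \<theta> j = tensor_form (a j) (\<phi> j) \<theta>" for \<theta> j
  \<comment> \<open>\<open>lim\<close> makes u total; it is the actual limit wherever convergence is
    known, by \<open>u_eq\<close>.\<close>
  define u where "u \<theta> = lim (\<lambda>N. \<Sum>j=1..N. T \<theta> j)" for \<theta>
  have u_eq: "u \<theta> = l" if "(\<lambda>N. \<Sum>j=1..N. T \<theta> j) \<longlonglongrightarrow> l" for \<theta> l
    using limI[OF that] by (simp add: u_def)
  have lin: "linear_form_on (gevrey \<sigma>) (a j)" if "j \<ge> 1" for j
    using assms(11)[OF that] by (simp add: gevrey_dual_def)
  have sch: "schwartz (\<phi> j)" if "j \<ge> 1" for j
    using assms(7)[OF that] by (rule gelfand_shilov_schwartz) simp

  \<comment> \<open>One constant for all \<theta> of level A. Convergence on \<open>S_space\<close>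
    follows because it is the union of the levels, and the constant is the one that continuity
    requires for this A.\<close>
  have estimate: "\<exists>C>0. \<forall>\<theta>\<in>S_C_space \<sigma> \<mu> A. (\<lambda>N. \<Sum>j=1..N. T \<theta> j) \<longlonglongrightarrow> u \<theta> \<and>
      cmod (u \<theta>) \<le> C * enn2real (S_norm \<sigma> \<mu> A \<theta>) \<and> (\<forall>j\<ge>1. coefficient (\<phi> j) \<theta> 0 \<in> gevrey \<sigma>)"
    if A: "A > 0" for A
  proof -
    obtain \<epsilon> C where \<epsilon>: "\<epsilon> > 0" "C > 0" and dec:
      "\<And>\<theta> j. \<theta> \<in> S_C_space \<sigma> \<mu> A \<Longrightarrow> j \<ge> 1 \<Longrightarrow> coefficient (\<phi> j) \<theta> 0 \<in> gevrey_h \<sigma> A \<and>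
        gevrey_norm \<sigma> A (coefficient (\<phi> j) \<theta> 0) \<le> ennreal (C * exp (- \<epsilon> * ?y j) * enn2real (S_norm \<sigma> \<mu> A \<theta>))"
      using coefficient_decay[OF \<mu>(1,3) A assms(6,7,8,10)] by blast
    \<comment> \<open>The growth of a_j is taken at half the decay rate and with h = A, so that exp
      (- \<epsilon> y / 2) remains for the summation.\<close>
    obtain B where B: "B > 0" and Bd: "\<And>j \<psi>. j \<ge> 1 \<Longrightarrow> \<psi> \<in> gevrey_h \<sigma> A \<Longrightarrow> ennreal (cmod (a j \<psi>)) \<le>
        ennreal B * gevrey_norm \<sigma> A \<psi> * ennreal (exp (\<epsilon> / 2 * ?y j))"
      using assms(12)[of "\<epsilon> / 2" A] \<epsilon> A by auto
    define e where "e k = exp (- (\<epsilon> / 2) * ?y (Suc k))" for k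
    have e: "summable e"
      unfolding e_def using summable_exp_neg_powr[of "\<epsilon> / 2" "1 / (2 * real CARD('n) * \<mu>)"] \<epsilon> \<mu>
      by (subst summable_Suc_iff) auto
    have "(\<lambda>N. \<Sum>j=1..N. T \<theta> j) \<longlonglongrightarrow> u \<theta> \<and>
        cmod (u \<theta>) \<le> (B * C * suminf e + 1) * enn2real (S_norm \<sigma> \<mu> A \<theta>) \<and>
        (\<forall>j\<ge>1. coefficient (\<phi> j) \<theta> 0 \<in> gevrey \<sigma>)" if \<theta>: "\<theta> \<in> S_C_space \<sigma> \<mu> A" for \<theta>
    proof -
      let ?N = "enn2real (S_norm \<sigma> \<mu> A \<theta>)"
      have bd: "norm (T \<theta> (Suc k)) \<le> B * C * ?N * e k" for k
      proof -
        let ?j = "Suc k" and ?\<psi> = "coefficient (\<phi> (Suc k)) \<theta> 0"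
        have "ennreal (cmod (a ?j ?\<psi>)) \<le>
            ennreal B * ennreal (C * exp (- \<epsilon> * ?y ?j) * ?N) * ennreal (exp (\<epsilon> / 2 * ?y ?j))"
          using dec[OF \<theta>, of ?j]
          by (intro order_trans[OF Bd[of ?j ?\<psi>]] mult_right_mono mult_left_mono) auto
        also have "\<dots> = ennreal (B * C * ?N * (exp (- \<epsilon> * ?y ?j) * exp (\<epsilon> / 2 * ?y ?j)))"
          using B \<epsilon> by (simp add: mult_ac flip: ennreal_mult)
        also have "exp (- \<epsilon> * ?y ?j) * exp (\<epsilon> / 2 * ?y ?j) = e k"
          by (simp add: e_def flip: exp_add)
        finally show ?thesis
          using B \<epsilon> by (simp add: T_def tensor_form_coefficient e_def)
      qed
      have sum_e: "summable (\<lambda>k. B * C * ?N * e k)" using e by (rule summable_mult)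
      have sumT: "summable (\<lambda>k. norm (T \<theta> (Suc k)))"
        by (rule summable_comparison_test'[OF sum_e, of 0]) (use bd in simp)
      have "(\<lambda>N. \<Sum>j=1..N. T \<theta> j) \<longlonglongrightarrow> (\<Sum>k. T \<theta> (Suc k))"
        using summable_LIMSEQ[OF summable_norm_cancel[OF sumT]] by (simp add: sum.atLeast1_atMost_eq)
      moreover from u_eq[OF this] have u: "u \<theta> = (\<Sum>k. T \<theta> (Suc k))" .
      moreover have "cmod (u \<theta>) \<le> B * C * ?N * suminf e"
        unfolding u using suminf_le[OF bd sumT sum_e] summable_norm[OF sumT] suminf_mult[OF e]
        by simp
      then have "cmod (u \<theta>) \<le> (B * C * suminf e + 1) * ?N"
        by (simp add: algebra_simps add_increasing)
      ultimately show ?thesis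
        using dec[OF \<theta>] A by (auto simp: gevrey_def)
    qed
    \<comment> \<open>The added 1 makes the constant strictly positive, as \<open>S_dual\<close>
      demands.\<close>
    moreover have "B * C * suminf e + 1 > 0"
      using B \<epsilon> suminf_nonneg[OF e] by (intro add_nonneg_pos) (auto simp: e_def)
    ultimately show ?thesis by blast
  qed

  have conv: "(\<lambda>N. \<Sum>j=1..N. T \<theta> j) \<longlonglongrightarrow> u \<theta>" and gev: "j \<ge> 1 \<Longrightarrow> coefficient (\<phi> j) \<theta> 0 \<in> gevrey \<sigma>"
    if "\<theta> \<in> S_space \<sigma> \<mu>" for \<theta> j
    using that estimate unfolding S_space_def by (blast, blast)

  have "linear_form_on (S_space \<sigma> \<mu>) u"
    unfolding linear_form_on_def
  proof (intro conjI ballI allI)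
    fix f g :: "real \<times> (real^'n) \<Rightarrow> complex" assume f: "f \<in> S_space \<sigma> \<mu>" and g: "g \<in> S_space \<sigma> \<mu>"
    have "T (\<lambda>x. f x + g x) j = T f j + T g j" if j: "j \<ge> 1" for j
    proof -
      have int: "integrable lborel (\<lambda>x. h (t, x) * \<phi> j x)" if "h \<in> S_space \<sigma> \<mu>" for h t
        using that S_C_space_schwartz[OF _ _ \<mu>(1), where k = 0] sch[OF j]
        unfolding S_space_def by (fastforce intro: integrable_schwartz_mult)
      have "coefficient (\<phi> j) (\<lambda>x. f x + g x) 0 = (\<lambda>t. coefficient (\<phi> j) f 0 t + coefficient (\<phi> j) g 0 t)"
        by (simp add: coefficient_def[abs_def] distrib_right Bochner_Integration.integral_add int f g)
      then show ?thesis
        using lin[OF j] gev[OF f j] gev[OF g j]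
        by (simp add: T_def tensor_form_coefficient linear_form_on_def)
    qed
    then have "(\<Sum>j=1..N. T (\<lambda>x. f x + g x) j) = (\<Sum>j=1..N. T f j) + (\<Sum>j=1..N. T g j)" for N
      by (simp flip: sum.distrib)
    then show "u (\<lambda>x. f x + g x) = u f + u g"
      using tendsto_add[OF conv[OF f] conv[OF g]] by (intro u_eq) simp
  next
    fix z and f :: "real \<times> (real^'n) \<Rightarrow> complex" assume f: "f \<in> S_space \<sigma> \<mu>"
    have "T (\<lambda>x. z * f x) j = z * T f j" if j: "j \<ge> 1" for j
    proof -
      have "coefficient (\<phi> j) (\<lambda>x. z * f x) 0 = (\<lambda>t. z * coefficient (\<phi> j) f 0 t)"
        by (simp add: coefficient_def[abs_def] mult.assoc)
      then show ?thesis
        using lin[OF j] gev[OF f j] by (simp add: T_def tensor_form_coefficient linear_form_on_def)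
    qed
    then have "(\<Sum>j=1..N. T (\<lambda>x. z * f x) j) = z * (\<Sum>j=1..N. T f j)" for N
      by (simp add: sum_distrib_left)
    then show "u (\<lambda>x. z * f x) = z * u f"
      using tendsto_mult_left[OF conv[OF f]] by (intro u_eq) simp
  qed
  moreover have "\<exists>C>0. \<forall>\<theta>\<in>S_space \<sigma> \<mu>. ennreal (cmod (u \<theta>)) \<le> ennreal C * S_norm \<sigma> \<mu> A \<theta>" if A: "A > 0" for A
  proof -
    obtain C where C: "C > 0" "\<And>\<theta>. \<theta> \<in> S_C_space \<sigma> \<mu> A \<Longrightarrow> cmod (u \<theta>) \<le> C * enn2real (S_norm \<sigma> \<mu> A \<theta>)"
      using estimate[OF A] by blast
    have "ennreal (cmod (u \<theta>)) \<le> ennreal C * S_norm \<sigma> \<mu> A \<theta>" if \<theta>: "\<theta> \<in> S_space \<sigma> \<mu>" for \<theta>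
    \<comment> \<open>If the norm is finite, \<theta> lies in level A, whatever level it came from;
      if it is infinite, so is the right-hand side, because C > 0.\<close>
    proof (cases "S_norm \<sigma> \<mu> A \<theta> < \<infinity>")
      case True
      then have "\<theta> \<in> S_C_space \<sigma> \<mu> A" using \<theta> by (auto simp: S_space_def S_C_space_def)
      then have "ennreal (cmod (u \<theta>)) \<le> ennreal (C * enn2real (S_norm \<sigma> \<mu> A \<theta>))"
        by (intro ennreal_leI C)
      also have "\<dots> = ennreal C * S_norm \<sigma> \<mu> A \<theta>"
        using C True by (simp add: ennreal_mult less_top)
      finally show ?thesis .
    next
      case False
      then show ?thesis using C by (simp add: less_top[symmetric] ennreal_mult_top)
    qed
    then show ?thesis using C by blast
  qed
  ultimately have dual: "u \<in> S_dual \<sigma> \<mu>" by (simp add: S_dual_def)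

  have coeff: "a j \<psi> = u (\<lambda>(t, x). \<psi> t * cnj (\<phi> j x))" if \<psi>: "\<psi> \<in> gevrey \<sigma>" and j: "j \<ge> 1" for \<psi> j
  proof -
    let ?\<theta> = "\<lambda>(t, x). \<psi> t * cnj (\<phi> j x)"
    have T: "T ?\<theta> k = (if k = j then a j \<psi> else 0)" if k: "k \<ge> 1" for k
    proof -
      \<comment> \<open>The conjugate in the test function turns the bilinear pairing into the inner
        product \<open>L2_inner (\<phi> k) (\<phi> j)\<close>.\<close>
      have "(\<lambda>t. \<integral>x. ?\<theta> (t, x) * \<phi> k x \<partial>lborel) = (\<lambda>t. L2_inner (\<phi> k) (\<phi> j) * \<psi> t)"
        by (simp add: L2_inner_def mult_ac flip: integral_mult_right_zero)
      moreover have "L2_inner (\<phi> k) (\<phi> j) = (if k = j then 1 else 0)"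
        using assms(6) j k by (simp add: orthonormal_basis_L2_def)
      moreover have "a k (\<lambda>t. z * \<psi> t) = z * a k \<psi>" for z
        using lin[OF k] \<psi> by (simp add: linear_form_on_def)
      ultimately have "T ?\<theta> k = (if k = j then 1 else 0) * a k \<psi>"
        unfolding T_def tensor_form_def by simp
      then show ?thesis by simp
    qed
    \<comment> \<open>Only the term k = j survives, so the partial sums are constant from N = j on
      and \<open>u_eq\<close> applies directly.\<close>
    have "(\<lambda>N. \<Sum>k=1..N. T ?\<theta> k) \<longlonglongrightarrow> a j \<psi>"
    proof (rule tendsto_eventually)
      show "\<forall>\<^sub>F N in sequentially. (\<Sum>k=1..N. T ?\<theta> k) = a j \<psi>"
        using eventually_ge_at_top[of j] by eventually_elim (use T j in \<open>simp add: sum.delta\<close>)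
    qed
    then show ?thesis by (simp add: u_eq)
  qed
  have "\<forall>\<psi>\<in>gevrey \<sigma>. \<forall>j\<ge>1. a j \<psi> = u (\<lambda>(t, x). \<psi> t * \<phi> j x)" if "\<forall>j\<ge>1. \<forall>x. \<phi> j x \<in> \<real>"
    using coeff that by (simp add: Reals_cnj_iff)
  with dual conv coeff show ?thesis unfolding T_def by blast
qed

end
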